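(* Let $d\ge3$ and let $B=(B_t)_{t\ge0}$ be a stationary Brownian motion on $\mathbb{T}^d$, with occupation measure $\mu_T^B=\int_0^T\delta_{B_t}\,dt$. Then, for every $p>0$ such that $p<(d-2)/3$ if $d\in\{3,4\}$, or $$p<(d-2)\cdot\frac{1+p/d}{3+p/d}\quad\text{if } d\ge5,$$ it holds, almost surely, $$\lim_{T\to\infty}\frac{\left|W^p_{\mathbb{T}^d}(\mu_T^B)-\mathbb{E}\left[W^p_{\mathbb{T}^d}(\mu_T^B)\right]\right|}{T^{1-p/(d-2)}}=0.$$
   Context: $\mathbb{T}^d=\mathbb{R}^d/\mathbb{Z}^d$ carries the flat distance $\mathsf{d}_{\mathbb{T}^d}(x,y)=\inf_{z\in\mathbb{Z}^d}|x-y-z|$ and uniform probability measure. A stationary Brownian motion on $\mathbb{T}^d$ is the projection of standard Brownian motion on $\mathbb{R}^d$ (generator $\frac12\Delta$) with $B_0$ uniform on $\mathbb{T}^d$. For $p>0$ and a finite positive measure $\mu$ on $\mathbb{T}^d$, $W^p_{\mathbb{T}^d}(\mu)=\min_\pi\int\mathsf{d}_{\mathbb{T}^d}(x,y)^p\,d\pi(x,y)$ over measures $\pi$ on $\mathbb{T}^d\times\mathbb{T}^d$ with first marginal $\mu$ and second marginal $\mu(\mathbb{T}^d)$ times the uniform probability measure (no $1/p$-th power is taken). *)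

theory Defs
  imports "HOL-Probability.Probability"
begin

definition int_lattice :: "(real ^ 'n) set" where
  "int_lattice = {z. \<forall>i. z $ i \<in> \<int>}"

lemma int_lattice_0 [simp]: "0 \<in> int_lattice"
  by (simp add: int_lattice_def)

lemma int_lattice_uminus: "z \<in> int_lattice \<Longrightarrow> - z \<in> int_lattice"
  by (simp add: int_lattice_def)

lemma int_lattice_add: "z \<in> int_lattice \<Longrightarrow> w \<in> int_lattice \<Longrightarrow> z + w \<in> int_lattice"
  by (simp add: int_lattice_def)

lemma int_lattice_diff: "z \<in> int_lattice \<Longrightarrow> w \<in> int_lattice \<Longrightarrow> z - w \<in> int_lattice"
  by (simp add: int_lattice_def)

quotient_type 'n torus = "real ^ 'n::finite" / "\<lambda>x y. x - y \<in> int_lattice"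
  morphisms rep_torus torus_proj
proof (rule equivpI)
  show "reflp (\<lambda>x y::real^'n. x - y \<in> int_lattice)"
    by (simp add: reflp_def)
  show "symp (\<lambda>x y::real^'n. x - y \<in> int_lattice)"
    by (rule sympI) (metis int_lattice_uminus minus_diff_eq)
  show "transp (\<lambda>x y::real^'n. x - y \<in> int_lattice)"
    by (rule transpI) (metis int_lattice_add diff_add_cancel add_diff_eq)
qed

definition lattice_dist :: "real ^ 'n \<Rightarrow> real ^ 'n \<Rightarrow> real" where
  "lattice_dist x y = (INF z\<in>int_lattice. norm (x - y - z))"

lemma lattice_dist_le: "z \<in> int_lattice \<Longrightarrow> lattice_dist x y \<le> norm (x - y - z)"
  unfolding lattice_dist_def by (rule cINF_lower) (auto intro!: bdd_belowI2[where m=0])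

lemma lattice_dist_greatest:
  "(\<And>z. z \<in> int_lattice \<Longrightarrow> m \<le> norm (x - y - z)) \<Longrightarrow> m \<le> lattice_dist x y"
  unfolding lattice_dist_def by (rule cINF_greatest) (auto intro: int_lattice_0)

lemma lattice_dist_near:
  assumes "lattice_dist x y < e"
  obtains z where "z \<in> int_lattice" "norm (x - y - z) < e"
  using assms lattice_dist_greatest[of e x y] by force

lemma lattice_dist_shift:
  fixes x x' y y' :: "real ^ 'n"
  assumes "x - x' \<in> int_lattice" "y - y' \<in> int_lattice"
  shows "lattice_dist x y \<le> lattice_dist x' y'"
proof (rule lattice_dist_greatest)
  fix z :: "real^'n" assume z: "z \<in> int_lattice"
  have "lattice_dist x y \<le> norm (x - y - (z + ((x - x') - (y - y'))))"
    by (intro lattice_dist_le int_lattice_add int_lattice_diff z assms)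
  then show "lattice_dist x y \<le> norm (x' - y' - z)"
    by (simp add: algebra_simps)
qed

lemma lattice_dist_cong:
  fixes x x' y y' :: "real ^ 'n"
  assumes "x - x' \<in> int_lattice" "y - y' \<in> int_lattice"
  shows "lattice_dist x y = lattice_dist x' y'"
proof (rule antisym)
  show "lattice_dist x' y' \<le> lattice_dist x y"
    by (rule lattice_dist_shift) (use assms int_lattice_uminus minus_diff_eq in metis)+
qed (rule lattice_dist_shift[OF assms])

lemma lattice_dist_triangle:
  fixes x y w :: "real ^ 'n"
  shows "lattice_dist x y \<le> lattice_dist x w + lattice_dist y w"
proof -
  have "lattice_dist x y - norm (x - w - a) \<le> lattice_dist y w" if a: "a \<in> int_lattice" for a
  proof (rule lattice_dist_greatest)
    fix b :: "real^'n" assume b: "b \<in> int_lattice"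
    have "lattice_dist x y \<le> norm (x - y - (a - b))"
      by (intro lattice_dist_le int_lattice_diff a b)
    also have "\<dots> = norm ((x - w - a) - (y - w - b))" by (simp add: algebra_simps)
    also have "\<dots> \<le> norm (x - w - a) + norm (y - w - b)" by (rule norm_triangle_ineq4)
    finally show "lattice_dist x y - norm (x - w - a) \<le> norm (y - w - b)" by simp
  qed
  then have "lattice_dist x y - lattice_dist y w \<le> lattice_dist x w"
    by (intro lattice_dist_greatest) force
  then show ?thesis by simp
qed

lemma lattice_dist_eq_0_iff:
  fixes x y :: "real ^ 'n"
  shows "lattice_dist x y = 0 \<longleftrightarrow> x - y \<in> int_lattice"
proof
  assume "x - y \<in> int_lattice"
  then have "lattice_dist x y \<le> 0" using lattice_dist_le[of "x - y" x y] by simp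
  moreover have "0 \<le> lattice_dist x y" by (rule lattice_dist_greatest) simp
  ultimately show "lattice_dist x y = 0" by simp
next
  assume 0: "lattice_dist x y = 0"
  have "(x - y) $ i \<in> \<int>" for i
  proof -
    have "(x - y) $ i \<in> closure (\<int> :: real set)"
    proof (subst closure_approachable, intro allI impI)
      fix e :: real assume "e > 0"
      with 0 obtain z where z: "z \<in> int_lattice" "norm (x - y - z) < e"
        using lattice_dist_near[of x y e] by auto
      then have "\<bar>(x - y - z) $ i\<bar> < e" using component_le_norm_cart[of "x - y - z" i] by linarith
      then show "\<exists>k\<in>\<int>. dist k ((x - y) $ i) < e"
        using z(1) by (intro bexI[of _ "z $ i"]) (auto simp: int_lattice_def dist_real_def abs_minus_commute)
    qed
    moreover have "closed (\<int> :: real set)" by (rule closed_Ints)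
    ultimately show ?thesis by (simp add: closure_closed)
  qed
  then show "x - y \<in> int_lattice" by (simp add: int_lattice_def)
qed

instantiation torus :: (finite) metric_space
begin

lift_definition dist_torus :: "'a torus \<Rightarrow> 'a torus \<Rightarrow> real" is lattice_dist
  by (rule lattice_dist_cong)

definition uniformity_torus :: "('a torus \<times> 'a torus) filter" where
  "uniformity_torus = (INF e\<in>{0 <..}. principal {(x, y). dist x y < e})"

definition open_torus :: "'a torus set \<Rightarrow> bool" where
  "open_torus U \<longleftrightarrow> (\<forall>x\<in>U. \<forall>\<^sub>F (x', y) in uniformity. x' = x \<longrightarrow> y \<in> U)"

instance
proof
  show "dist x y = 0 \<longleftrightarrow> x = y" for x y :: "'a torus"
    by transfer (rule lattice_dist_eq_0_iff)
  show "dist x y \<le> dist x z + dist y z" for x y z :: "'a torus"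
    by transfer (rule lattice_dist_triangle)
qed (simp_all add: uniformity_torus_def open_torus_def)

end

definition torus_uniform :: "'n::finite torus measure" where
  "torus_uniform = distr (uniform_measure lborel (cbox 0 1)) borel torus_proj"

text \<open>Standard Brownian motion with arbitrary initial law; taking \<open>t 0 = 0\<close> in the
  independence clause makes \<open>X 0\<close> independent of all increments.\<close>

definition brownian_motion :: "'w measure \<Rightarrow> (real \<Rightarrow> 'w \<Rightarrow> real ^ 'n) \<Rightarrow> bool" where
  "brownian_motion M X \<longleftrightarrow>
     prob_space M \<and>
     (\<forall>t\<ge>0. X t \<in> borel_measurable M) \<and>
     (\<forall>t :: nat \<Rightarrow> real. t 0 = 0 \<and> mono t \<longrightarrow>
        prob_space.indep_vars M (\<lambda>_. borel)
          (\<lambda>k \<omega>. case k of 0 \<Rightarrow> X 0 \<omega> | Suc j \<Rightarrow> X (t (Suc j)) \<omega> - X (t j) \<omega>) UNIV) \<and>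
     (\<forall>s t. 0 \<le> s \<and> s < t \<longrightarrow>
        distributed M lborel (\<lambda>\<omega>. X t \<omega> - X s \<omega>)
          (\<lambda>x. ennreal (\<Prod>i\<in>UNIV. normal_density 0 (sqrt (t - s)) (x $ i)))) \<and>
     (AE \<omega> in M. continuous_on {0..} (\<lambda>t. X t \<omega>))"

definition stationary_torus_bm ::
    "'w measure \<Rightarrow> (real \<Rightarrow> 'w \<Rightarrow> 'n::finite torus) \<Rightarrow> bool" where
  "stationary_torus_bm M B \<longleftrightarrow>
     (\<exists>X. brownian_motion M X \<and>
          (\<forall>t\<ge>0. \<forall>\<omega>\<in>space M. B t \<omega> = torus_proj (X t \<omega>))) \<and>
     distr M borel (B 0) = torus_uniform"

text \<open>\<open>occupation_measure B T \<omega>\<close> gives a Borel set \<open>A\<close> the Lebesgue measure of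
  \<open>{t \<in> {0..T}. B t \<omega> \<in> A}\<close>.\<close>

definition occupation_measure ::
    "(real \<Rightarrow> 'w \<Rightarrow> 'n::finite torus) \<Rightarrow> real \<Rightarrow> 'w \<Rightarrow> 'n torus measure" where
  "occupation_measure B T \<omega> = distr (restrict_space lborel {0..T}) borel (\<lambda>t. B t \<omega>)"

definition uniform_couplings ::
    "'n::finite torus measure \<Rightarrow> ('n torus \<times> 'n torus) measure set" where
  "uniform_couplings \<mu> =
     {\<pi>. sets \<pi> = sets (borel \<Otimes>\<^sub>M borel) \<and>
         distr \<pi> borel fst = \<mu> \<and>
         distr \<pi> borel snd = scale_measure (emeasure \<mu> UNIV) torus_uniform}"

text \<open>The infimum is attained (compactness of the torus), so it is the minimal transport cost;
  no \<open>1/p\<close>-th power is taken.  The distance on the torus is bounded, so for \<open>p > 0\<close> and finite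
  \<open>\<mu>\<close> the value is finite and \<open>enn2real\<close> loses nothing.\<close>

definition torus_Wp :: "real \<Rightarrow> 'n::finite torus measure \<Rightarrow> ennreal" where
  "torus_Wp p \<mu> =
     (INF \<pi>\<in>uniform_couplings \<mu>. \<integral>\<^sup>+ (x, y). ennreal (dist x y powr p) \<partial>\<pi>)"

end

theory Submission
  imports Defs "HOL-Real_Asymp.Real_Asymp"
begin

text \<open>The exponent in the denominator exceeds \<open>1/2\<close>: both hypotheses on \<open>p\<close> force
  \<open>p < (d - 2) / 2\<close> (\<open>exponent_below_half\<close>).  It therefore suffices that \<open>W\<^sup>p(\<mu>\<^sub>T)\<close> has
  sub-Gaussian fluctuations of order \<open>\<surd>T\<close> around its mean, which is an Azuma--Hoeffding
  phenomenon resting on two properties.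

  First, the transport cost is Lipschitz in total variation for every \<open>p > 0\<close>: altering the path
  during a time span of length \<open>h\<close> changes \<open>W\<^sup>p(\<mu>\<^sub>T)\<close> by at most \<open>h\<close> times a bound for
  the cost, which is finite because the torus is compact.  This and the continuity of \<open>W\<^sup>p\<close> in the
  path both follow from one comparison, \<open>torus_Wp_distr_le\<close>, which transfers a coupling of one
  image measure to another image of the same measure.  Exact gluing of couplings would require
  disintegration; gluing up to a small error needs only a countable partition into small cells,
  inside which the source point and the given plan are drawn independently.

  Second, Brownian motion on the torus forgets its position at a uniform rate: its density at time
  one is bounded below, so averaging a periodic function over a unit increment contracts the
  oscillation by a fixed factor (\<open>gaussian_step_contracts\<close>).  Consequently the conditional
  expectation of \<open>W\<^sup>p(\<mu>\<^sub>n)\<close> given the first \<open>j\<close> unit blocks of the path moves by a bounded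
  amount, independent of \<open>n\<close> and \<open>j\<close>, when the \<open>j\<close>-th block is changed, although such a change
  displaces the whole future.  Hoeffding's lemma, applied block by block, gives exponential moments
  (\<open>exponential_moment\<close>).

  To work with finitely many independent Gaussian increments, the path is first frozen on a grid of
  mesh \<open>1/m\<close>; all constants are uniform in \<open>m\<close>, and continuity of paths allows \<open>m \<rightarrow> \<infinity>\<close>
  (\<open>limit_cost\<close>).  Markov's inequality and Borel--Cantelli then control integer times, and
  intermediate times cost only a bounded error (\<open>occ_cost_time_diff\<close>).\<close>

section \<open>The flat torus\<close>

lemma torus_proj_eq_iff: "torus_proj x = torus_proj y \<longleftrightarrow> x - y \<in> int_lattice"
  by (simp add: torus.abs_eq_iff)

lemma dist_torus_proj: "dist (torus_proj x) (torus_proj y) = lattice_dist x y"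
  by (simp add: dist_torus.abs_eq)

lemma dist_torus_proj_le: "dist (torus_proj x) (torus_proj y) \<le> dist x y"
  using lattice_dist_le[of 0 x y] by (simp add: dist_torus_proj dist_norm)

lemma continuous_on_torus_proj: "continuous_on A torus_proj"
  unfolding continuous_on_iff
  by (meson dist_torus_proj_le order.strict_trans1)

lemma torus_proj_measurable [measurable]: "torus_proj \<in> borel_measurable borel"
  by (rule borel_measurable_continuous_onI) (rule continuous_on_torus_proj)

lemma surj_torus_proj: "\<exists>x. q = torus_proj x"
  by (metis Quotient3_abs_rep Quotient3_torus)

lemma torus_proj_ball: "torus_proj ` ball x e = ball (torus_proj x) e"
proof (intro set_eqI iffI)
  fix q assume "q \<in> torus_proj ` ball x e"
  then show "q \<in> ball (torus_proj x) e"
    by (auto intro: order.strict_trans1[OF dist_torus_proj_le])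
next
  fix q assume q: "q \<in> ball (torus_proj x) e"
  obtain y where y: "q = torus_proj y" using surj_torus_proj by blast
  then have "lattice_dist x y < e" using q by (simp add: dist_torus_proj)
  then obtain z where z: "z \<in> int_lattice" "norm (x - y - z) < e" by (rule lattice_dist_near)
  then have "q = torus_proj (y + z)" by (simp add: y torus_proj_eq_iff int_lattice_uminus)
  moreover have "y + z \<in> ball x e" using z by (simp add: dist_norm algebra_simps)
  ultimately show "q \<in> torus_proj ` ball x e" by blast
qed

lemma open_torus_proj_image: "open U \<Longrightarrow> open (torus_proj ` U)"
proof (subst open_contains_ball, intro ballI)
  fix q assume U: "open U" and "q \<in> torus_proj ` U"
  then obtain x where x: "x \<in> U" "q = torus_proj x" by blast
  with U obtain e where "e > 0" "ball x e \<subseteq> U" by (meson open_contains_ball)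
  then show "\<exists>e>0. ball q e \<subseteq> torus_proj ` U"
    unfolding x(2) torus_proj_ball[symmetric] by blast
qed

text \<open>The projection is open, so a countable base of the Euclidean space projects to one of the torus.
  Second countability makes the distance jointly measurable on the product \<open>\<sigma>\<close>-algebra.\<close>
instance torus :: (finite) second_countable_topology
proof
  obtain \<B> :: "(real ^ 'a) set set" where \<B>: "countable \<B>" "topological_basis \<B>"
    using ex_countable_basis by blast
  have "topological_basis ((`) torus_proj ` \<B>)"
  proof (rule topological_basisI)
    fix b assume "b \<in> (`) torus_proj ` \<B>"
    then obtain b' where "b' \<in> \<B>" "b = torus_proj ` b'" by blast
    then show "open b"
      by (simp add: open_torus_proj_image topological_basis_open[OF \<B>(2)])
  next
    fix V :: "'a torus set" and q assume V: "open V" "q \<in> V"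
    obtain x where x: "q = torus_proj x" using surj_torus_proj by blast
    have "open (torus_proj -` V)"
      using V continuous_on_torus_proj[of UNIV] open_vimage by auto
    moreover have "x \<in> torus_proj -` V" using V x by simp
    ultimately obtain b where "b \<in> \<B>" "x \<in> b" "b \<subseteq> torus_proj -` V"
      by (rule topological_basisE[OF \<B>(2)])
    then show "\<exists>b\<in>(`) torus_proj ` \<B>. q \<in> b \<and> b \<subseteq> V"
      unfolding x by (intro bexI[of _ "torus_proj ` b"]) auto
  qed
  then show "\<exists>B::'a torus set set. countable B \<and> open = generate_topology B"
    by (intro exI[of _ "(`) torus_proj ` \<B>"] conjI countable_image \<B>(1)
      topological_basis_imp_subbasis)
qed

definition floor_vec :: "real ^ 'n \<Rightarrow> real ^ 'n" where
  "floor_vec x = (\<chi> i. of_int \<lfloor>x $ i\<rfloor>)"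

lemma floor_vec_lattice: "floor_vec x \<in> int_lattice"
  by (simp add: floor_vec_def int_lattice_def)

lemma frac_vec_in_cube: "x - floor_vec x \<in> cbox 0 1"
proof -
  have "x $ i \<le> 1 + of_int \<lfloor>x $ i\<rfloor>" for i by linarith
  then show ?thesis by (simp add: mem_box_cart floor_vec_def algebra_simps)
qed

lemma dist_torus_le: "dist (q :: 'n::finite torus) r \<le> real CARD('n)"
proof -
  obtain x y where *: "q = torus_proj x" "r = torus_proj y" using surj_torus_proj by metis
  let ?v = "x - y - floor_vec (x - y)"
  have "dist q r \<le> norm ?v"
    by (simp add: * dist_torus_proj lattice_dist_le floor_vec_lattice)
  also have "\<dots> \<le> (\<Sum>i\<in>UNIV. \<bar>?v $ i\<bar>)" by (rule norm_le_l1_cart)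
  also have "\<dots> \<le> (\<Sum>i\<in>(UNIV::'n set). 1)"
    using frac_vec_in_cube[of "x - y"] by (intro sum_mono) (auto simp: mem_box_cart)
  finally show ?thesis by simp
qed

lemma emeasure_unit_cube: "emeasure lborel (cbox 0 1 :: (real ^ 'n::finite) set) = 1"
proof -
  have *: "(1 :: real ^ 'n) \<bullet> b = 1" if "b \<in> Basis" for b
    using that by (auto simp: Basis_vec_def inner_axis)
  show ?thesis by (subst emeasure_lborel_cbox) (auto simp: * )
qed

lemma prob_space_torus_uniform: "prob_space (torus_uniform :: 'n::finite torus measure)"
proof -
  note emeasure_unit_cube [simp]
  interpret prob_space "uniform_measure lborel (cbox 0 1 :: (real^'n) set)"
    by (rule prob_space_uniform_measure) auto
  show ?thesis unfolding torus_uniform_def by (rule prob_space_distr) simp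
qed

lemma dist_powr_le:
  "p \<ge> 0 \<Longrightarrow> dist (x :: 'n::finite torus) y powr p \<le> real CARD('n) powr p"
  by (intro powr_mono2 dist_torus_le) auto

lemma dist_powr_modulus:
  assumes "p > 0" "\<eta> > 0"
  obtains \<delta> where "\<delta> > 0"
    "\<And>x x' y :: 'n::finite torus. dist x x' < \<delta> \<Longrightarrow> dist x y powr p \<le> dist x' y powr p + \<eta>"
proof -
  have "uniformly_continuous_on {0..real CARD('n)} (\<lambda>r. r powr p)"
    using assms by (intro compact_uniformly_continuous continuous_on_powr') (auto intro: continuous_intros)
  then obtain \<delta> where \<delta>: "\<delta> > 0"
    "\<And>r s. r \<in> {0..real CARD('n)} \<Longrightarrow> s \<in> {0..real CARD('n)} \<Longrightarrow> dist r s < \<delta> \<Longrightarrow> dist (r powr p) (s powr p) < \<eta>"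
    using assms(2) unfolding uniformly_continuous_on_def by metis
  show ?thesis
  proof (rule that[OF \<delta>(1)])
    fix x x' y :: "'n torus" assume "dist x x' < \<delta>"
    moreover have "dist (dist x y) (dist x' y) \<le> dist x x'"
      by (metis abs_dist_diff_le dist_commute dist_real_def)
    ultimately have "dist (dist x y powr p) (dist x' y powr p) < \<eta>"
      by (intro \<delta>(2)) (auto simp: dist_torus_le)
    then show "dist x y powr p \<le> dist x' y powr p + \<eta>" by (simp add: dist_real_def)
  qed
qed

lemma dist_powr_diff_modulus:
  assumes "p > 0" "\<eta> > 0"
  obtains \<delta> where "\<delta> > 0"
    "\<And>x x' y :: 'n::finite torus. dist x x' < \<delta> \<Longrightarrow> \<bar>dist x y powr p - dist x' y powr p\<bar> \<le> \<eta>"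
proof -
  obtain \<delta> where \<delta>: "\<delta> > 0"
    "\<And>x x' y :: 'n torus. dist x x' < \<delta> \<Longrightarrow> dist x y powr p \<le> dist x' y powr p + \<eta>"
    using dist_powr_modulus[OF assms] by metis
  show ?thesis
  proof (rule that[OF \<delta>(1)])
    fix x x' y :: "'n torus" assume d: "dist x x' < \<delta>"
    then have "dist x' x < \<delta>" by (simp add: dist_commute)
    from \<delta>(2)[OF d, of y] \<delta>(2)[OF this, of y]
    show "\<bar>dist x y powr p - dist x' y powr p\<bar> \<le> \<eta>" by linarith
  qed
qed

section \<open>Approximate gluing and stability of the transport cost\<close>

lemma AE_label_charged:
  fixes i :: "'a \<Rightarrow> nat"
  assumes [measurable]: "i \<in> measurable L (count_space UNIV)"
  shows "AE s in L. emeasure L {x \<in> space L. i x = i s} \<noteq> 0"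
proof -
  have "AE s in L. i s = k \<longrightarrow> emeasure L {x \<in> space L. i x = k} \<noteq> 0" for k
  proof (cases "emeasure L {x \<in> space L. i x = k} = 0")
    case True
    then have "AE s in L. i s \<noteq> k" by (subst AE_iff_measurable[OF _ refl]) auto
    then show ?thesis by eventually_elim simp
  qed simp
  then have "AE s in L. \<forall>k. i s = k \<longrightarrow> emeasure L {x \<in> space L. i x = k} \<noteq> 0"
    by (intro AE_all_countable[THEN iffD2] allI)
  then show ?thesis by eventually_elim simp
qed

text \<open>Two finite measures with the same distribution of a countable label have a coupling under which
  the labels agree: condition the product measure on equality of the labels, that is, draw the two
  points independently within each label class.  The density divides by the mass of the class, which
  is nonzero almost everywhere.\<close>
lemma coupling_with_equal_labels:
  fixes i :: "'a \<Rightarrow> nat" and j :: "'b \<Rightarrow> nat"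
  assumes "finite_measure L" "finite_measure P"
    and [measurable]: "i \<in> measurable L (count_space UNIV)" "j \<in> measurable P (count_space UNIV)"
    and eq: "\<And>k. emeasure L {x \<in> space L. i x = k} = emeasure P {y \<in> space P. j y = k}"
  obtains R where "sets R = sets (L \<Otimes>\<^sub>M P)" "distr R L fst = L" "distr R P snd = P"
    "AE x in R. i (fst x) = j (snd x)"
proof -
  interpret L: finite_measure L by fact
  interpret P: finite_measure P by fact
  interpret LP: pair_sigma_finite L P ..
  define m where "m k = emeasure P {y \<in> space P. j y = k}" for k
  \<comment> \<open>The density of the product measure conditioned on equal labels.\<close>
  define w where "w x = (if i (fst x) = j (snd x) then 1 / m (j (snd x)) else 0)" for x
  define R where "R = density (L \<Otimes>\<^sub>M P) w"
  have [measurable]: "(\<lambda>q. m (j q)) \<in> borel_measurable P"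
    by (rule measurable_compose[OF assms(4)]) simp
  have [measurable]: "Measurable.pred (L \<Otimes>\<^sub>M P) (\<lambda>x. i (fst x) = j (snd x))"
  proof -
    have "Measurable.pred (L \<Otimes>\<^sub>M P) (\<lambda>x. \<exists>k. i (fst x) = k \<and> j (snd x) = k)" by measurable
    moreover have "(\<lambda>x. \<exists>k. i (fst x) = k \<and> j (snd x) = k) = (\<lambda>x. i (fst x) = j (snd x))" by auto
    ultimately show ?thesis by metis
  qed
  have w[measurable]: "w \<in> borel_measurable (L \<Otimes>\<^sub>M P)"
    unfolding w_def by measurable
  have mfin: "m k \<noteq> \<infinity>" for k unfolding m_def by (simp add: P.emeasure_finite)
  have m1: "1 / m k * m k = 1" if "m k \<noteq> 0" for k
    using that mfin[of k] ennreal_divide_self[of "m k"]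
    by (simp add: divide_ennreal_def mult.commute less_top)
  have aeL: "AE s in L. m (i s) \<noteq> 0"
    using AE_label_charged[OF assms(3)] by (simp add: m_def eq)
  have aeP: "AE q in P. m (j q) \<noteq> 0"
    using AE_label_charged[OF assms(4)] by (simp add: m_def)
  show thesis
  proof (rule that[of R])
    show "sets R = sets (L \<Otimes>\<^sub>M P)" by (simp add: R_def)
    have spR: "space R = space L \<times> space P" by (simp add: R_def space_pair_measure)
    show "distr R L fst = L"
    proof (rule measure_eqI)
      fix A assume "A \<in> sets (distr R L fst)"
      then have A[measurable]: "A \<in> sets L" by simp
      have "emeasure (distr R L fst) A = emeasure R (fst -` A \<inter> space R)"
        by (subst emeasure_distr) (auto simp: R_def)
      also have "\<dots> = (\<integral>\<^sup>+ x. w x * indicator A (fst x) \<partial>(L \<Otimes>\<^sub>M P))"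
        unfolding R_def by (subst emeasure_density) (auto intro!: nn_integral_cong split: split_indicator)
      also have "\<dots> = (\<integral>\<^sup>+ s. \<integral>\<^sup>+ q. w (s, q) * indicator A s \<partial>P \<partial>L)"
        by (subst P.nn_integral_fst[symmetric]) auto
      also have "\<dots> = (\<integral>\<^sup>+ s. \<integral>\<^sup>+ q. (1 / m (i s) * indicator A s) * indicator {q \<in> space P. j q = i s} q \<partial>P \<partial>L)"
        by (intro nn_integral_cong) (auto simp: w_def split: split_indicator)
      also have "\<dots> = (\<integral>\<^sup>+ s. (1 / m (i s) * indicator A s) * m (i s) \<partial>L)"
        by (intro nn_integral_cong, subst nn_integral_cmult_indicator) (auto simp: m_def)
      also have "\<dots> = (\<integral>\<^sup>+ s. indicator A s \<partial>L)"
        using aeL by (intro nn_integral_cong_AE, eventually_elim) (metis m1 mult.commute mult.left_commute mult_1)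
      finally show "emeasure (distr R L fst) A = emeasure L A" by simp
    qed simp
    show "distr R P snd = P"
    proof (rule measure_eqI)
      fix A assume "A \<in> sets (distr R P snd)"
      then have A[measurable]: "A \<in> sets P" by simp
      have "emeasure (distr R P snd) A = emeasure R (snd -` A \<inter> space R)"
        by (subst emeasure_distr) (auto simp: R_def)
      also have "\<dots> = (\<integral>\<^sup>+ x. w x * indicator A (snd x) \<partial>(L \<Otimes>\<^sub>M P))"
        unfolding R_def by (subst emeasure_density) (auto intro!: nn_integral_cong split: split_indicator)
      also have "\<dots> = (\<integral>\<^sup>+ q. \<integral>\<^sup>+ s. w (s, q) * indicator A q \<partial>L \<partial>P)"
        by (subst LP.nn_integral_snd[symmetric]) auto
      also have "\<dots> = (\<integral>\<^sup>+ q. \<integral>\<^sup>+ s. (1 / m (j q) * indicator A q) * indicator {s \<in> space L. i s = j q} s \<partial>L \<partial>P)"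
        by (intro nn_integral_cong) (auto simp: w_def split: split_indicator)
      also have "\<dots> = (\<integral>\<^sup>+ q. (1 / m (j q) * indicator A q) * m (j q) \<partial>P)"
        by (intro nn_integral_cong, subst nn_integral_cmult_indicator) (auto simp: m_def eq)
      also have "\<dots> = (\<integral>\<^sup>+ q. indicator A q \<partial>P)"
        using aeP by (intro nn_integral_cong_AE, eventually_elim) (metis m1 mult.commute mult.left_commute mult_1)
      finally show "emeasure (distr R P snd) A = emeasure P A" by simp
    qed simp
    show "AE x in R. i (fst x) = j (snd x)"
      unfolding R_def by (subst AE_density) (auto simp: w_def intro!: AE_I2 split: split_indicator_asm)
  qed
qed

text \<open>A countable partition into sets of small diameter, given by its labelling function: every point
  is sent to the first member of a dense sequence that lies close to it.\<close>
lemma torus_partition: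
  assumes "\<delta> > 0"
  obtains J :: "'n::finite torus \<Rightarrow> nat"
  where "J \<in> measurable borel (count_space UNIV)" "\<And>x y. J x = J y \<Longrightarrow> dist x y < \<delta>"
proof -
  obtain D :: "'n torus set" where D: "countable D" "\<And>X. open X \<Longrightarrow> X \<noteq> {} \<Longrightarrow> \<exists>d\<in>D. d \<in> X"
    using countable_dense_setE by blast
  define e where "e = from_nat_into D"
  have e: "\<exists>k. dist (e k) x < \<delta>/2" for x
  proof -
    obtain d where "d \<in> D" "d \<in> ball x (\<delta>/2)" using D(2)[of "ball x (\<delta>/2)"] assms by auto
    then show ?thesis using from_nat_into_surj[OF D(1)] unfolding e_def
      by (metis dist_commute mem_ball)
  qed
  define J where "J x = (LEAST k. dist (e k) x < \<delta>/2)" for x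
  have J: "dist (e (J x)) x < \<delta>/2" for x unfolding J_def using e by (rule LeastI_ex)
  show ?thesis
  proof
    show "J \<in> measurable borel (count_space UNIV)" unfolding J_def by measurable
    fix x y assume "J x = J y"
    then show "dist x y < \<delta>" using J[of x] J[of y] dist_triangle_half_r[of "e (J x)" x \<delta> y] by simp
  qed
qed

lemma le_INF_add_const:
  fixes f :: "'a \<Rightarrow> ennreal"
  assumes "\<And>i. i \<in> I \<Longrightarrow> x \<le> f i + c"
  shows "x \<le> (INF i\<in>I. f i) + c"
proof (cases "c = \<top>")
  case False
  then have "x - c \<le> (INF i\<in>I. f i)"
    using assms by (intro INF_greatest) (simp add: ennreal_minus_le_iff add.commute)
  then show ?thesis using False by (simp add: ennreal_minus_le_iff add.commute)
qed simp

text \<open>A transport plan for the image under \<open>f\<close> is pulled back to the source space, up to an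
  arbitrarily small error, by coupling source and plan so that \<open>f s\<close> and the starting point of the
  plan lie in the same small cell; it is then pushed forward along \<open>g\<close> instead of \<open>f\<close>.  The cost
  rises by at most the integral of the pointwise excess \<open>h\<close>.\<close>
lemma torus_Wp_distr_le:
  fixes f g :: "'s \<Rightarrow> 'n::finite torus"
  assumes "finite_measure L" and p: "p > 0"
    and [measurable]: "f \<in> borel_measurable L" "g \<in> borel_measurable L" "h \<in> borel_measurable L"
    and le: "\<And>s y. s \<in> space L \<Longrightarrow> ennreal (dist (g s) y powr p) \<le> ennreal (dist (f s) y powr p) + h s"
  shows "torus_Wp p (distr L borel g) \<le> torus_Wp p (distr L borel f) + (\<integral>\<^sup>+ s. h s \<partial>L)"
proof -
  interpret L: finite_measure L by fact
  have main: "torus_Wp p (distr L borel g)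
      \<le> (\<integral>\<^sup>+ (x, y). ennreal (dist x y powr p) \<partial>\<pi>) + (\<integral>\<^sup>+ s. h s \<partial>L) + ennreal \<eta> * emeasure L (space L)"
    if \<pi>: "\<pi> \<in> uniform_couplings (distr L borel f)" and \<eta>: "\<eta> > 0" for \<pi> \<eta>
  proof -
    have s\<pi>[measurable_cong]: "sets \<pi> = sets (borel \<Otimes>\<^sub>M borel)"
      and d1: "distr \<pi> borel fst = distr L borel f"
      and d2: "distr \<pi> borel snd = scale_measure (emeasure (distr L borel f) UNIV) torus_uniform"
      using \<pi> by (auto simp: uniform_couplings_def)
    have sp: "space \<pi> = UNIV" using sets_eq_imp_space_eq[OF s\<pi>] by (simp add: space_pair_measure)
    obtain \<delta> where \<delta>: "\<delta> > 0"
      "\<And>x x' y :: 'n torus. dist x x' < \<delta> \<Longrightarrow> dist x y powr p \<le> dist x' y powr p + \<eta>"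
      using dist_powr_modulus[OF p \<eta>] by metis
    obtain J :: "'n torus \<Rightarrow> nat" where J[measurable]: "J \<in> measurable borel (count_space UNIV)"
      and J\<delta>: "\<And>x y. J x = J y \<Longrightarrow> dist x y < \<delta>"
      using torus_partition[OF \<delta>(1)] by metis
    have fst_eq: "emeasure L {x \<in> space L. f x \<in> A} = emeasure \<pi> {y \<in> space \<pi>. fst y \<in> A}"
      if [measurable]: "A \<in> sets borel" for A
    proof -
      have "emeasure (distr \<pi> borel fst) A = emeasure (distr L borel f) A" by (simp add: d1)
      then show ?thesis
        by (simp add: emeasure_distr vimage_def Int_def conj_commute)
    qed
    have fin\<pi>: "finite_measure \<pi>"
      using fst_eq[of UNIV] L.emeasure_finite by (intro finite_measureI) auto
    obtain R where R[measurable_cong]: "sets R = sets (L \<Otimes>\<^sub>M \<pi>)"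
      and RL: "distr R L fst = L" and R\<pi>: "distr R \<pi> snd = \<pi>"
      and RJ: "AE x in R. J (f (fst x)) = J (fst (snd x))"
    proof (rule coupling_with_equal_labels[of L \<pi> "\<lambda>s. J (f s)" "\<lambda>q. J (fst q)"])
      fix k
      show "emeasure L {x \<in> space L. J (f x) = k} = emeasure \<pi> {y \<in> space \<pi>. J (fst y) = k}"
        using fst_eq[of "J -` {k}"] measurable_sets[OF J, of "{k}"] by simp
    qed (use fin\<pi> assms(1) in auto)
    have spR: "space R = space L \<times> UNIV"
      using sets_eq_imp_space_eq[OF R] by (simp add: space_pair_measure sp)
    define \<pi>' where "\<pi>' = distr R (borel \<Otimes>\<^sub>M borel) (\<lambda>x. (g (fst x), snd (snd x)))"
    have "distr \<pi>' borel fst = distr (distr R L fst) borel g"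
      unfolding \<pi>'_def by (simp add: distr_distr comp_def)
    moreover have "distr \<pi>' borel snd = distr (distr R \<pi> snd) borel snd"
      unfolding \<pi>'_def by (simp add: distr_distr comp_def)
    ultimately have "\<pi>' \<in> uniform_couplings (distr L borel g)"
      unfolding uniform_couplings_def RL R\<pi> d2 by (auto simp: \<pi>'_def emeasure_distr)
    then have "torus_Wp p (distr L borel g) \<le> (\<integral>\<^sup>+ (x, y). ennreal (dist x y powr p) \<partial>\<pi>')"
      unfolding torus_Wp_def by (rule INF_lower)
    also have "\<dots> = (\<integral>\<^sup>+ x. ennreal (dist (g (fst x)) (snd (snd x)) powr p) \<partial>R)"
      unfolding \<pi>'_def by (subst nn_integral_distr) (auto simp: case_prod_beta)
    also have "\<dots> \<le> (\<integral>\<^sup>+ x. ennreal (dist (fst (snd x)) (snd (snd x)) powr p) + h (fst x) + ennreal \<eta> \<partial>R)"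
    proof (rule nn_integral_mono_AE, use RJ AE_space in eventually_elim)
      fix x assume x: "J (f (fst x)) = J (fst (snd x))" "x \<in> space R"
      have "ennreal (dist (f (fst x)) (snd (snd x)) powr p)
          \<le> ennreal (dist (fst (snd x)) (snd (snd x)) powr p + \<eta>)"
        using J\<delta>[OF x(1)] by (intro ennreal_leI \<delta>(2))
      also have "\<dots> = ennreal (dist (fst (snd x)) (snd (snd x)) powr p) + ennreal \<eta>"
        using \<eta> by simp
      finally show "ennreal (dist (g (fst x)) (snd (snd x)) powr p)
          \<le> ennreal (dist (fst (snd x)) (snd (snd x)) powr p) + h (fst x) + ennreal \<eta>"
        using le[of "fst x" "snd (snd x)"] x(2) spR
        by (smt (verit, ccfv_threshold) add.assoc add.commute add_right_mono mem_Sigma_iff order.trans prod.collapse)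
    qed
    also have "\<dots> = (\<integral>\<^sup>+ x. ennreal (dist (fst (snd x)) (snd (snd x)) powr p) \<partial>R) + (\<integral>\<^sup>+ x. h (fst x) \<partial>R)
        + ennreal \<eta> * emeasure R (space R)"
      by (simp add: nn_integral_add)
    also have "(\<integral>\<^sup>+ x. h (fst x) \<partial>R) = (\<integral>\<^sup>+ s. h s \<partial>(distr R L fst))"
      by (subst nn_integral_distr) auto
    also have "(\<integral>\<^sup>+ x. ennreal (dist (fst (snd x)) (snd (snd x)) powr p) \<partial>R)
        = (\<integral>\<^sup>+ q. ennreal (dist (fst q) (snd q) powr p) \<partial>(distr R \<pi> snd))"
      by (subst nn_integral_distr) auto
    also have "emeasure R (space R) = emeasure (distr R L fst) (space L)"
      by (subst emeasure_distr) (auto simp: spR intro!: arg_cong[where f="emeasure R"])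
    finally show ?thesis by (simp add: RL R\<pi> split_beta')
  qed
  show ?thesis
  proof (rule ennreal_le_epsilon)
    fix e :: real assume e: "e > 0"
    define \<eta> where "\<eta> = e / (measure L (space L) + 1)"
    have \<eta>: "\<eta> > 0" unfolding \<eta>_def using e by (intro divide_pos_pos) (auto intro: add_nonneg_pos)
    have "\<eta> * measure L (space L) \<le> e"
    proof -
      have "measure L (space L) + 1 > 0" by (simp add: add_nonneg_pos)
      then show ?thesis unfolding \<eta>_def using e by (simp add: field_simps)
    qed
    then have \<eta>e: "ennreal \<eta> * emeasure L (space L) \<le> ennreal e"
      using \<eta> by (simp add: L.emeasure_eq_measure ennreal_mult[symmetric] ennreal_leI)
    show "torus_Wp p (distr L borel g)
        \<le> torus_Wp p (distr L borel f) + (\<integral>\<^sup>+ s. h s \<partial>L) + ennreal e"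
      unfolding torus_Wp_def[of p "distr L borel f"] add.assoc
      by (intro le_INF_add_const order.trans[OF main[OF _ \<eta>]])
        (simp_all only: add.assoc, intro add_left_mono \<eta>e)
  qed
qed

lemma scale_distr: "distr (scale_measure c M) N f = scale_measure c (distr M N f)"
  if "f \<in> measurable M N"
proof (rule measure_eqI)
  fix A assume "A \<in> sets (distr (scale_measure c M) N f)"
  then have "A \<in> sets N" by simp
  then show "emeasure (distr (scale_measure c M) N f) A = emeasure (scale_measure c (distr M N f)) A"
    using that by (subst emeasure_distr) (simp_all add: emeasure_distr space_scale_measure)
qed simp

lemma torus_Wp_scale_le:
  assumes "c > 0"
  shows "torus_Wp p (scale_measure (ennreal c) \<mu>) \<le> ennreal c * torus_Wp p \<mu>"
proof -
  have *: "torus_Wp p (scale_measure (ennreal c) \<mu>) \<le> ennreal c * (\<integral>\<^sup>+ (x, y). ennreal (dist x y powr p) \<partial>\<pi>)"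
    if \<pi>: "\<pi> \<in> uniform_couplings \<mu>" for \<pi>
  proof -
    have s\<pi>[measurable_cong]: "sets \<pi> = sets (borel \<Otimes>\<^sub>M borel)" using \<pi> by (simp add: uniform_couplings_def)
    have "scale_measure (ennreal c) \<pi> \<in> uniform_couplings (scale_measure (ennreal c) \<mu>)"
      using \<pi> by (simp add: uniform_couplings_def scale_distr scale_scale_measure mult.commute)
    then have "torus_Wp p (scale_measure (ennreal c) \<mu>)
        \<le> (\<integral>\<^sup>+ (x, y). ennreal (dist x y powr p) \<partial>scale_measure (ennreal c) \<pi>)"
      unfolding torus_Wp_def by (rule INF_lower)
    also have "\<dots> = ennreal c * (\<integral>\<^sup>+ (x, y). ennreal (dist x y powr p) \<partial>\<pi>)"
      by (rule nn_integral_scale_measure) measurable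
    finally show ?thesis .
  qed
  have "ennreal (1 / c) * torus_Wp p (scale_measure (ennreal c) \<mu>) \<le> torus_Wp p \<mu>"
    unfolding torus_Wp_def[of p \<mu>]
  proof (rule INF_greatest)
    fix \<pi> assume "\<pi> \<in> uniform_couplings \<mu>"
    then have "ennreal (1 / c) * torus_Wp p (scale_measure (ennreal c) \<mu>)
        \<le> ennreal (1 / c) * (ennreal c * (\<integral>\<^sup>+ (x, y). ennreal (dist x y powr p) \<partial>\<pi>))"
      by (intro mult_left_mono *) auto
    also have "\<dots> = (\<integral>\<^sup>+ (x, y). ennreal (dist x y powr p) \<partial>\<pi>)"
      using assms by (simp add: mult.assoc[symmetric] ennreal_mult[symmetric])
    finally show "ennreal (1 / c) * torus_Wp p (scale_measure (ennreal c) \<mu>)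
        \<le> (\<integral>\<^sup>+ (x, y). ennreal (dist x y powr p) \<partial>\<pi>)" .
  qed
  then have "ennreal c * (ennreal (1 / c) * torus_Wp p (scale_measure (ennreal c) \<mu>)) \<le> ennreal c * torus_Wp p \<mu>"
    by (intro mult_left_mono) auto
  then show ?thesis using assms by (simp add: mult.assoc[symmetric] ennreal_mult[symmetric])
qed

lemma torus_Wp_scale:
  assumes "c > 0"
  shows "torus_Wp p (scale_measure (ennreal c) \<mu>) = ennreal c * torus_Wp p \<mu>"
proof (rule antisym[OF torus_Wp_scale_le[OF assms]])
  have "ennreal (1 / c) * ennreal c = 1" using assms by (simp add: ennreal_mult[symmetric])
  then have "scale_measure (ennreal (1 / c)) (scale_measure (ennreal c) \<mu>) = \<mu>"
    by (simp add: scale_scale_measure mult.commute)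
  with torus_Wp_scale_le[of "1 / c" p "scale_measure (ennreal c) \<mu>"] assms
  have "torus_Wp p \<mu> \<le> ennreal (1 / c) * torus_Wp p (scale_measure (ennreal c) \<mu>)" by simp
  then have "ennreal c * torus_Wp p \<mu> \<le> ennreal c * (ennreal (1 / c) * torus_Wp p (scale_measure (ennreal c) \<mu>))"
    by (intro mult_left_mono) auto
  then show "ennreal c * torus_Wp p \<mu> \<le> torus_Wp p (scale_measure (ennreal c) \<mu>)"
    using assms by (simp add: mult.assoc[symmetric] ennreal_mult[symmetric])
qed

text \<open>The diameter of the torus is at most the sum of the side lengths of the unit cube.\<close>
definition cost_bound :: "'n::finite itself \<Rightarrow> real \<Rightarrow> real" where
  "cost_bound _ p = real CARD('n) powr p"

lemma cost_bound_nonneg: "0 \<le> cost_bound TYPE('n::finite) p"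
  by (simp add: cost_bound_def)

text \<open>The product of \<open>\<mu>\<close> with the uniform law is an admissible plan.\<close>
lemma torus_Wp_le:
  fixes \<mu> :: "'n::finite torus measure"
  assumes "sets \<mu> = sets borel" "finite_measure \<mu>" "p \<ge> 0"
  shows "torus_Wp p \<mu> \<le> ennreal (cost_bound TYPE('n) p * measure \<mu> UNIV)"
proof -
  interpret finite_measure \<mu> by fact
  interpret U: prob_space "torus_uniform :: 'n torus measure" by (rule prob_space_torus_uniform)
  interpret PU: pair_sigma_finite \<mu> "torus_uniform :: 'n torus measure" ..
  have sp[simp]: "space \<mu> = UNIV" using sets_eq_imp_space_eq[OF assms(1)] by simp
  have su[measurable_cong, simp]: "sets (torus_uniform :: 'n torus measure) = sets borel"
    by (simp add: torus_uniform_def)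
  have spu[simp]: "space (torus_uniform :: 'n torus measure) = UNIV"
    using sets_eq_imp_space_eq[OF su] by simp
  note assms(1)[measurable_cong]
  let ?\<pi> = "\<mu> \<Otimes>\<^sub>M (torus_uniform :: 'n torus measure)"
  have e1: "emeasure torus_uniform (UNIV :: 'n torus set) = 1" using U.emeasure_space_1 by simp
  have "?\<pi> \<in> uniform_couplings \<mu>"
    unfolding uniform_couplings_def
  proof (intro CollectI conjI)
    show "sets ?\<pi> = sets (borel \<Otimes>\<^sub>M borel)"
      by (intro sets_pair_measure_cong assms su)
    show "distr ?\<pi> borel fst = \<mu>"
    proof (rule measure_eqI)
      fix A :: "'n torus set" assume "A \<in> sets (distr ?\<pi> borel fst)"
      then have [measurable]: "A \<in> sets borel" by simp
      have "emeasure (distr ?\<pi> borel fst) A = emeasure ?\<pi> (A \<times> UNIV)"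
        by (subst emeasure_distr) (auto simp: space_pair_measure intro!: arg_cong[where f="emeasure ?\<pi>"])
      also have "\<dots> = emeasure \<mu> A"
        by (subst U.emeasure_pair_measure_Times) (auto simp: e1 assms(1))
      finally show "emeasure (distr ?\<pi> borel fst) A = emeasure \<mu> A" .
    qed (simp add: assms)
    show "distr ?\<pi> borel snd = scale_measure (emeasure \<mu> UNIV) torus_uniform"
    proof (rule measure_eqI)
      fix A :: "'n torus set" assume "A \<in> sets (distr ?\<pi> borel snd)"
      then have [measurable]: "A \<in> sets borel" by simp
      have "emeasure (distr ?\<pi> borel snd) A = emeasure ?\<pi> (UNIV \<times> A)"
        by (subst emeasure_distr) (auto simp: space_pair_measure intro!: arg_cong[where f="emeasure ?\<pi>"])
      also have "\<dots> = emeasure \<mu> UNIV * emeasure torus_uniform A"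
        by (subst U.emeasure_pair_measure_Times) (auto simp: assms(1))
      finally show "emeasure (distr ?\<pi> borel snd) A = emeasure (scale_measure (emeasure \<mu> UNIV) torus_uniform) A"
        by simp
    qed (simp add: assms)
  qed
  then have "torus_Wp p \<mu> \<le> (\<integral>\<^sup>+ (x, y). ennreal (dist x y powr p) \<partial>?\<pi>)"
    unfolding torus_Wp_def by (rule INF_lower)
  also have "\<dots> \<le> (\<integral>\<^sup>+ z. ennreal (cost_bound TYPE('n) p) \<partial>?\<pi>)"
    using assms(3) by (intro nn_integral_mono) (auto simp: cost_bound_def intro!: ennreal_leI dist_powr_le)
  also have "\<dots> = ennreal (cost_bound TYPE('n) p) * emeasure ?\<pi> (UNIV \<times> UNIV)"
    by (simp add: space_pair_measure)
  also have "emeasure ?\<pi> (UNIV \<times> UNIV) = ennreal (measure \<mu> UNIV)"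
    by (subst U.emeasure_pair_measure_Times) (auto simp: e1 emeasure_eq_measure assms(1))
  finally show ?thesis by (simp add: ennreal_mult cost_bound_nonneg)
qed

lemma torus_Wp_distr_finite:
  fixes f :: "'s \<Rightarrow> 'n::finite torus"
  assumes "finite_measure L" "p > 0" "f \<in> borel_measurable L"
  shows "torus_Wp p (distr L borel f) < \<top>"
    and "enn2real (torus_Wp p (distr L borel f)) \<le> cost_bound TYPE('n) p * measure L (space L)"
proof -
  interpret finite_measure "distr L borel f" using assms finite_measure.finite_measure_distr by blast
  have "measure (distr L borel f) UNIV = measure L (space L)"
    using assms(3) by (subst measure_distr) auto
  then have *: "torus_Wp p (distr L borel f) \<le> ennreal (cost_bound TYPE('n) p * measure L (space L))"
    using torus_Wp_le[of "distr L borel f" p] assms finite_measure_axioms by simp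
  then show "torus_Wp p (distr L borel f) < \<top>" by (rule order.strict_trans1) simp
  show "enn2real (torus_Wp p (distr L borel f)) \<le> cost_bound TYPE('n) p * measure L (space L)"
    using * by (intro enn2real_leI) (auto simp: cost_bound_nonneg)
qed

text \<open>Closeness of \<open>f\<close> and \<open>g\<close> gives continuity of the cost, while the exceptional set \<open>A\<close> gives
  its Lipschitz dependence on the measure in total variation.\<close>
lemma torus_Wp_distr_diff:
  fixes f g :: "'s \<Rightarrow> 'n::finite torus"
  assumes L: "finite_measure L" and p: "p > 0" and \<eta>: "\<eta> \<ge> 0"
    and [measurable]: "f \<in> borel_measurable L" "g \<in> borel_measurable L" "A \<in> sets L"
    and close: "\<And>s y. s \<in> space L - A \<Longrightarrow> \<bar>dist (f s) y powr p - dist (g s) y powr p\<bar> \<le> \<eta>"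
  shows "\<bar>enn2real (torus_Wp p (distr L borel f)) - enn2real (torus_Wp p (distr L borel g))\<bar>
      \<le> \<eta> * measure L (space L) + cost_bound TYPE('n) p * measure L A"
proof -
  interpret finite_measure L by fact
  define h where "h s = ennreal \<eta> + ennreal (cost_bound TYPE('n) p) * indicator A s" for s
  have [measurable]: "h \<in> borel_measurable L" unfolding h_def by measurable
  have ih: "(\<integral>\<^sup>+ s. h s \<partial>L) = ennreal (\<eta> * measure L (space L) + cost_bound TYPE('n) p * measure L A)"
    unfolding h_def using \<eta>
    by (simp add: nn_integral_add nn_integral_cmult_indicator emeasure_eq_measure
        ennreal_mult cost_bound_nonneg)
  have one: "enn2real (torus_Wp p (distr L borel b)) \<le> enn2real (torus_Wp p (distr L borel a))
      + (\<eta> * measure L (space L) + cost_bound TYPE('n) p * measure L A)"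
    if [measurable]: "a \<in> borel_measurable L" "b \<in> borel_measurable L"
      and cl: "\<And>s y. s \<in> space L - A \<Longrightarrow> \<bar>dist (a s) y powr p - dist (b s) y powr p\<bar> \<le> \<eta>"
    for a b :: "'s \<Rightarrow> 'n torus"
  proof -
    have "torus_Wp p (distr L borel b) \<le> torus_Wp p (distr L borel a) + (\<integral>\<^sup>+ s. h s \<partial>L)"
    proof (rule torus_Wp_distr_le[OF L p])
      fix s and y :: "'n torus" assume s: "s \<in> space L"
      show "ennreal (dist (b s) y powr p) \<le> ennreal (dist (a s) y powr p) + h s"
      proof (cases "s \<in> A")
        case True
        have "ennreal (dist (b s) y powr p) \<le> ennreal (cost_bound TYPE('n) p)"
          unfolding cost_bound_def using p by (intro ennreal_leI dist_powr_le) auto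
        also have "\<dots> \<le> ennreal (dist (a s) y powr p) + h s"
          using True by (simp add: h_def add_increasing)
        finally show ?thesis .
      next
        case False
        with cl[of s y] s have "dist (b s) y powr p \<le> dist (a s) y powr p + \<eta>" by auto
        then have "ennreal (dist (b s) y powr p) \<le> ennreal (dist (a s) y powr p + \<eta>)" by (rule ennreal_leI)
        then show ?thesis using False \<eta> by (simp add: h_def)
      qed
    qed measurable
    moreover have "torus_Wp p (distr L borel a) < \<top>" "torus_Wp p (distr L borel b) < \<top>"
      by (intro torus_Wp_distr_finite(1)[OF L p] that)+
    moreover have "0 \<le> \<eta> * measure L (space L) + cost_bound TYPE('n) p * measure L A"
      using \<eta> by (simp add: cost_bound_nonneg)
    ultimately show ?thesis unfolding ih
      by (cases "torus_Wp p (distr L borel a)"; cases "torus_Wp p (distr L borel b)")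
        (auto simp flip: ennreal_plus)
  qed
  show ?thesis
    using one[of f g] one[of g f] close by (force simp: abs_minus_commute)
qed

section \<open>Occupation measures of paths\<close>

definition occ_cost :: "real \<Rightarrow> real \<Rightarrow> (real \<Rightarrow> 'n::finite torus) \<Rightarrow> real" where
  "occ_cost p T b = enn2real (torus_Wp p (distr (restrict_space lborel {0..T}) borel b))"

abbreviation time_interval :: "real \<Rightarrow> real measure" where
  "time_interval T \<equiv> restrict_space lborel {0..T}"

lemma measure_time_interval: "T \<ge> 0 \<Longrightarrow> measure (time_interval T) {0..T} = T"
  by (simp add: measure_restrict_space)

lemma finite_measure_time_interval: "finite_measure (time_interval T)"
  by (intro finite_measureI) (simp add: emeasure_restrict_space emeasure_lborel_Icc_eq)

lemma occ_cost_cong: "(\<And>t. t \<in> {0..T} \<Longrightarrow> b t = b' t) \<Longrightarrow> occ_cost p T b = occ_cost p T b'"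
  unfolding occ_cost_def by (intro arg_cong[where f="\<lambda>\<mu>. enn2real (torus_Wp p \<mu>)"] distr_cong) auto

lemma occ_cost_nonneg: "0 \<le> occ_cost p T b"
  by (simp add: occ_cost_def)

lemma occ_cost_le:
  fixes b :: "real \<Rightarrow> 'n::finite torus"
  assumes "p > 0" "T \<ge> 0" "b \<in> borel_measurable (time_interval T)"
  shows "occ_cost p T b \<le> cost_bound TYPE('n) p * T"
  using torus_Wp_distr_finite(2)[OF finite_measure_time_interval assms(1,3)] assms(2)
  by (simp add: occ_cost_def measure_time_interval)

lemma occ_cost_close:
  fixes b b' :: "real \<Rightarrow> 'n::finite torus"
  assumes "p > 0" "T \<ge> 0" "\<eta> \<ge> 0"
    "b \<in> borel_measurable (time_interval T)" "b' \<in> borel_measurable (time_interval T)" "A \<in> sets (time_interval T)"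
    "\<And>t y. t \<in> {0..T} - A \<Longrightarrow> \<bar>dist (b t) y powr p - dist (b' t) y powr p\<bar> \<le> \<eta>"
  shows "\<bar>occ_cost p T b - occ_cost p T b'\<bar> \<le> \<eta> * T + cost_bound TYPE('n) p * measure (time_interval T) A"
  using torus_Wp_distr_diff[OF finite_measure_time_interval assms(1,3-6)] assms(2,7)
  by (simp add: occ_cost_def measure_time_interval)

text \<open>The measures \<open>\<mu>\<^sub>T\<close> and \<open>\<mu>\<^sub>S\<close> have different masses, so \<open>\<mu>\<^sub>T\<close> is compared with the
  rescaled \<open>(T/S) \<mu>\<^sub>S\<close>.  Both are images of the product of time on \<open>[0,T]\<close> with an independent
  uniform time \<open>u \<in> [0,S]\<close>: the first under \<open>(t,u) \<mapsto> b t\<close>, the second under the same map with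
  \<open>b u\<close> in place of \<open>b t\<close> once \<open>t > S\<close>.  The maps differ only on a set of mass \<open>T - S\<close>.\<close>
lemma occ_cost_time_diff:
  fixes b :: "real \<Rightarrow> 'n::finite torus"
  assumes p: "p > 0" and S: "0 < S" "S \<le> T" and [measurable]: "b \<in> borel_measurable borel"
  shows "\<bar>occ_cost p T b - occ_cost p S b\<bar> \<le> 2 * cost_bound TYPE('n) p * (T - S)"
proof -
  define U where "U = uniform_measure lborel {0..S}"
  interpret U: prob_space U
    unfolding U_def using S by (intro prob_space_uniform_measure) auto
  interpret T: finite_measure "time_interval T" by (rule finite_measure_time_interval)
  interpret P: pair_sigma_finite "time_interval T" U ..
  have sU[measurable_cong]: "sets U = sets borel" by (simp add: U_def)
  have spU[simp]: "space U = UNIV" by (simp add: U_def)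
  define L where "L = time_interval T \<Otimes>\<^sub>M U"
  have spL: "space L = {0..T} \<times> UNIV" by (simp add: L_def space_pair_measure)
  have [measurable]: "{t. t \<le> S} \<in> sets borel" by measurable
  have idm[measurable]: "(\<lambda>t. t) \<in> measurable (time_interval T) borel"
    by (rule measurable_restrict_space1) simp
  have [measurable]: "b \<in> borel_measurable (time_interval T)"
    by (rule measurable_restrict_space1) simp
  have eL: "emeasure L (X \<times> Y) = emeasure (time_interval T) X * emeasure U Y"
    if "X \<in> sets (time_interval T)" "Y \<in> sets borel" for X Y
    unfolding L_def using that by (subst U.emeasure_pair_measure_Times) (auto simp: sU)
  interpret L: finite_measure L
    using eL[of "{0..T}" UNIV] by (intro finite_measureI) (auto simp: spL U.emeasure_space_1[simplified]
        emeasure_restrict_space sets_restrict_space_iff emeasure_lborel_Icc_eq)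
  \<comment> \<open>The two maps whose images are to be compared; the second coordinate is the auxiliary time.\<close>
  define f where "f x = b (fst x)" for x :: "real \<times> real"
  define g where "g x = (if fst x \<le> S then b (fst x) else b (snd x))" for x :: "real \<times> real"
  have [measurable]: "f \<in> borel_measurable L" "g \<in> borel_measurable L"
    unfolding f_def g_def L_def by measurable
  define A where "A = {S<..T} \<times> (UNIV :: real set)"
  have intA: "X \<in> sets (time_interval T)" if "X \<in> sets borel" "X \<subseteq> {0..T}" for X
    using that by (simp add: sets_restrict_space_iff)
  have mint: "emeasure (time_interval T) X = emeasure lborel X" if "X \<in> sets borel" "X \<subseteq> {0..T}" for X
    using that by (simp add: emeasure_restrict_space)
  have mST: "emeasure (time_interval T) {S<..T} = ennreal (T - S)"
    using S by (subst mint) auto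
  have A[measurable]: "A \<in> sets L"
    unfolding A_def L_def using S by (intro pair_measureI intA) (auto simp: sU)
  have emA: "emeasure L A = ennreal (T - S)"
    unfolding A_def using S by (subst eL) (auto intro!: intA simp: mST U.emeasure_space_1[simplified])
  then have mA: "measure L A = T - S" using S by (simp add: measure_def)
  have "distr L borel f = distr (time_interval T) borel b"
  proof (rule measure_eqI)
    fix X :: "'n torus set" assume "X \<in> sets (distr L borel f)"
    then have X[measurable]: "X \<in> sets borel" by simp
    have "emeasure (distr L borel f) X = emeasure L (({0..T} \<inter> b -` X) \<times> UNIV)"
      by (subst emeasure_distr) (auto simp: spL f_def intro!: arg_cong[where f="emeasure L"])
    also have "\<dots> = emeasure (time_interval T) ({0..T} \<inter> b -` X)"
      by (subst eL) (auto intro!: intA simp: U.emeasure_space_1[simplified])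
    also have "\<dots> = emeasure (distr (time_interval T) borel b) X"
      by (subst emeasure_distr) (auto simp: Int_commute)
    finally show "emeasure (distr L borel f) X = emeasure (distr (time_interval T) borel b) X" .
  qed simp
  moreover have "distr L borel g = scale_measure (ennreal (T / S)) (distr (time_interval S) borel b)"
  proof (rule measure_eqI)
    fix X :: "'n torus set" assume "X \<in> sets (distr L borel g)"
    then have X[measurable]: "X \<in> sets borel" by simp
    define Y where "Y = {0..S} \<inter> b -` X"
    have Y[measurable]: "Y \<in> sets borel" unfolding Y_def using measurable_sets[OF assms(4) X] by simp
    have Yfin: "emeasure lborel Y \<noteq> \<infinity>"
      using emeasure_mono[of Y "{0..S}" lborel] S by (auto simp: Y_def top_unique)
    have mY: "emeasure (time_interval T) Y = emeasure lborel Y"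
      using S by (intro mint Y) (auto simp: Y_def)
    have split: "g -` X \<inter> space L = Y \<times> UNIV \<union> {S<..T} \<times> (b -` X)"
      using S by (auto simp: spL g_def Y_def split: if_splits)
    have "emeasure (distr L borel g) X = emeasure L (Y \<times> UNIV \<union> {S<..T} \<times> (b -` X))"
      by (subst emeasure_distr) (auto simp: split)
    also have "\<dots> = emeasure L (Y \<times> UNIV) + emeasure L ({S<..T} \<times> (b -` X))"
      using S measurable_sets[OF assms(4) X] unfolding L_def
      by (intro plus_emeasure[symmetric] pair_measureI intA) (auto simp: Y_def sU)
    also have "emeasure L (Y \<times> UNIV) = emeasure lborel Y"
      using S Y by (subst eL) (auto intro!: intA simp: mY U.emeasure_space_1[simplified], auto simp: Y_def)
    also have "emeasure L ({S<..T} \<times> (b -` X)) = ennreal (T - S) * emeasure U (b -` X)"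
      using S measurable_sets[OF assms(4) X] by (subst eL) (auto intro!: intA simp: mST)
    also have "emeasure U (b -` X) = emeasure lborel Y / ennreal S"
      unfolding U_def Y_def using S measurable_sets[OF assms(4) X] by (subst emeasure_uniform_measure) auto
    also have "emeasure lborel Y + ennreal (T - S) * (emeasure lborel Y / ennreal S)
        = ennreal (T / S) * emeasure lborel Y"
    proof -
      obtain r where r: "emeasure lborel Y = ennreal r" "r \<ge> 0"
        using Yfin by (cases "emeasure lborel Y") auto
      have "ennreal r + ennreal (T - S) * (ennreal r / ennreal S) = ennreal (r + (T - S) * (r / S))"
        using S r(2) by (simp add: divide_ennreal ennreal_mult[symmetric])
      also have "r + (T - S) * (r / S) = T / S * r" using S by (simp add: field_simps)
      finally show ?thesis using S r(2) unfolding r(1) by (simp add: ennreal_mult[symmetric])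
    qed
    also have "emeasure lborel Y = emeasure (distr (time_interval S) borel b) X"
      using measurable_restrict_space1[OF assms(4)[unfolded measurable_lborel1[symmetric]], of "{0..S}"]
      by (subst emeasure_distr) (auto simp: Y_def emeasure_restrict_space Int_commute)
    finally show "emeasure (distr L borel g) X
        = emeasure (scale_measure (ennreal (T / S)) (distr (time_interval S) borel b)) X" by simp
  qed simp
  moreover have "\<bar>enn2real (torus_Wp p (distr L borel f)) - enn2real (torus_Wp p (distr L borel g))\<bar>
      \<le> 0 * measure L (space L) + cost_bound TYPE('n) p * measure L A"
    using A by (intro torus_Wp_distr_diff[OF L.finite_measure_axioms p])
      (auto simp: spL A_def f_def g_def)
  ultimately have 1: "\<bar>occ_cost p T b - (T / S) * occ_cost p S b\<bar> \<le> cost_bound TYPE('n) p * (T - S)"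
    using S by (simp add: occ_cost_def torus_Wp_scale enn2real_mult mA)
  have "(T / S) * occ_cost p S b - occ_cost p S b = (T - S) / S * occ_cost p S b"
    using S by (simp add: field_simps)
  moreover have "(T - S) / S * occ_cost p S b \<le> (T - S) / S * (cost_bound TYPE('n) p * S)"
    using S p by (intro mult_left_mono occ_cost_le measurable_restrict_space1) auto
  moreover have "0 \<le> (T - S) / S * occ_cost p S b" using S by (simp add: occ_cost_nonneg)
  moreover have "(T - S) / S * (cost_bound TYPE('n) p * S) = cost_bound TYPE('n) p * (T - S)"
    using S by simp
  moreover have "2 * cost_bound TYPE('n) p * (T - S) = cost_bound TYPE('n) p * (T - S) + cost_bound TYPE('n) p * (T - S)"
    by simp
  ultimately show ?thesis using 1 by linarith
qed

section \<open>One step of Gaussian mixing on the torus\<close>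

definition gauss_density :: "real ^ 'n \<Rightarrow> real" where
  "gauss_density x = (\<Prod>i\<in>UNIV. normal_density 0 1 (x $ i))"

text \<open>The standard Gaussian density at a corner of the cube \<open>[-1,1]\<^sup>d\<close>, hence its minimum over the
  differences of two points of the unit cube.\<close>
definition doeblin_const :: "'n::finite itself \<Rightarrow> real" where
  "doeblin_const _ = normal_density 0 1 1 ^ CARD('n)"

lemma doeblin_const_pos: "0 < doeblin_const TYPE('n::finite)"
  by (simp add: doeblin_const_def normal_density_pos)

lemma gauss_density_ge:
  fixes x y :: "real ^ 'n"
  assumes "x \<in> cbox 0 1" "y \<in> cbox 0 1"
  shows "doeblin_const TYPE('n) \<le> gauss_density (y - x)"
proof -
  have "normal_density 0 1 1 \<le> normal_density 0 1 ((y - x) $ i)" for i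
  proof -
    have "\<bar>(y - x) $ i\<bar> \<le> 1" using assms[unfolded mem_box_cart] by (simp add: abs_le_iff) (smt (verit))
    then have "((y - x) $ i)\<^sup>2 \<le> 1" by (simp add: abs_square_le_1)
    then show ?thesis by (simp add: normal_density_def divide_right_mono)
  qed
  then have "(\<Prod>i\<in>(UNIV::'n set). normal_density 0 1 1) \<le> (\<Prod>i\<in>UNIV. normal_density 0 1 ((y - x) $ i))"
    by (intro prod_mono) (auto simp: less_imp_le normal_density_pos)
  then show ?thesis by (simp add: doeblin_const_def gauss_density_def)
qed

text \<open>Doeblin's argument.  By periodicity both starting points may be moved into the unit cube, where
  the two shifted Gaussian densities dominate the same multiple of the uniform density on the cube.
  That common part contributes equally to both averages; only the remaining mass can tell the
  starting points apart.\<close>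
lemma gaussian_step_contracts:
  fixes G :: "real ^ 'n \<Rightarrow> real"
  assumes N: "prob_space N" "N = density lborel (\<lambda>x. ennreal (gauss_density x))"
    and [measurable]: "G \<in> borel_measurable borel"
    and per: "\<And>x y. x - y \<in> int_lattice \<Longrightarrow> G x = G y"
    and osc: "\<And>x y. \<bar>G x - G y\<bar> \<le> K"
  shows "\<bar>(\<integral>s. G (x + s) \<partial>N) - (\<integral>s. G (y + s) \<partial>N)\<bar> \<le> (1 - doeblin_const TYPE('n)) * K"
proof -
  let ?\<epsilon> = "doeblin_const TYPE('n)"
  let ?c = "cbox 0 1 :: (real^'n) set"
  interpret N: prob_space N by fact
  have [measurable]: "(gauss_density :: real^'n \<Rightarrow> real) \<in> borel_measurable borel"
    unfolding gauss_density_def by measurable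
  have g0: "0 \<le> gauss_density x" for x :: "real^'n"
    unfolding gauss_density_def by (intro prod_nonneg) auto
  have tot: "(\<integral>\<^sup>+ x. ennreal (gauss_density (x :: real^'n)) \<partial>lborel) = 1"
    using N.emeasure_space_1 unfolding N(2) by (subst (asm) emeasure_density) (auto cong: nn_integral_cong)
  have shift: "(\<integral>s. f (z + s) \<partial>lborel) = (\<integral>s. f s \<partial>lborel)"
    if [measurable]: "f \<in> borel_measurable borel" for f :: "real^'n \<Rightarrow> real" and z
  proof -
    have "(\<integral>s. f s \<partial>lborel) = (\<integral>s. f s \<partial>(distr lborel borel ((+) z)))" by (simp add: lborel_distr_plus)
    also have "\<dots> = (\<integral>s. f (z + s) \<partial>lborel)" by (rule integral_distr) auto
    finally show ?thesis by simp
  qed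
  have gi: "integrable lborel (\<lambda>s :: real^'n. gauss_density (s - z))" for z
  proof -
    have "integrable lborel (gauss_density :: real^'n \<Rightarrow> real)"
      by (rule integrableI_nn_integral_finite[where x=1]) (auto simp: g0 tot)
    then have "integrable (distr lborel borel ((+) (- z))) (gauss_density :: real^'n \<Rightarrow> real)"
      by (simp add: lborel_distr_plus)
    then show ?thesis by (subst (asm) integrable_distr_eq) auto
  qed
  have g1: "(\<integral>s. gauss_density (s - z) \<partial>lborel) = 1" for z :: "real^'n"
    using shift[of "\<lambda>s. gauss_density (s - z)" z] integral_eq_nn_integral[of gauss_density "lborel :: (real^'n) measure"]
    by (simp add: g0 tot)
  define a where "a = Inf (range G)"
  have bdd: "bdd_below (range G)"
    by (rule bdd_belowI2[where m="G 0 - K"]) (use osc in \<open>smt (verit)\<close>)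
  have H0: "0 \<le> G z - a" for z unfolding a_def using cINF_lower[OF bdd] by simp
  have HK: "G z - a \<le> K" for z
  proof -
    have "G z - K \<le> a" unfolding a_def using osc[of z] by (intro cINF_greatest) (auto simp: abs_le_iff algebra_simps)
    then show ?thesis by simp
  qed
  have Hint: "integrable lborel (\<lambda>s. f s * (G s - a))" if "integrable lborel f" for f
  proof (rule Bochner_Integration.integrable_bound)
    show "integrable lborel (\<lambda>s. K * f s)" using that by simp
    show "AE s in lborel. norm (f s * (G s - a)) \<le> norm (K * f s)"
    proof (rule AE_I2)
      fix s show "norm (f s * (G s - a)) \<le> norm (K * f s)"
        using H0[of s] HK[of s] mult_left_mono[OF HK[of s] abs_ge_zero[of "f s"]]
        by (simp add: abs_mult mult.commute)
    qed
    have "f \<in> borel_measurable lborel" using that by auto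
    then show "(\<lambda>s. f s * (G s - a)) \<in> borel_measurable lborel" by measurable
  qed
  define J where "J = (\<integral>s. (?\<epsilon> * indicator ?c s) * (G s - a) \<partial>lborel)"
  have icube: "integrable lborel (\<lambda>s :: real^'n. ?\<epsilon> * indicator ?c s)"
    using emeasure_lborel_cbox_finite[of 0 "1 :: real^'n"]
    by (intro integrable_mult_right) (simp add: integrable_indicator_iff less_top)
  have vol: "(\<integral>s. ?\<epsilon> * indicator ?c s \<partial>lborel) = ?\<epsilon>"
  proof -
    have m: "measure lborel ?c = 1" by (simp only: measure_def emeasure_unit_cube enn2real_1)
    have "(\<integral>s. ?\<epsilon> * indicator ?c s \<partial>lborel) = ?\<epsilon> * (\<integral>s. indicator ?c s \<partial>lborel)"
      by (rule integral_mult_right_zero)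
    also have "(\<integral>s. indicator ?c s \<partial>lborel) = measure lborel (?c \<inter> space lborel)"
      by (rule Bochner_Integration.integral_indicator)
    finally show ?thesis using m by (simp only: space_lborel space_borel Int_UNIV_right mult_1_right)
  qed
  have bound: "J + a \<le> (\<integral>s. G (x + s) \<partial>N) \<and> (\<integral>s. G (x + s) \<partial>N) \<le> J + a + (1 - ?\<epsilon>) * K" for x
  proof -
    define z where "z = x - floor_vec x"
    have zc: "z \<in> ?c" unfolding z_def by (rule frac_vec_in_cube)
    \<comment> \<open>What remains of the shifted density once the common uniform part is removed.\<close>
    define \<psi> where "\<psi> s = gauss_density (s - z) - ?\<epsilon> * indicator ?c s" for s
    have \<psi>0: "0 \<le> \<psi> s" for s
      unfolding \<psi>_def using gauss_density_ge[OF zc, of s] g0[of "s - z"] by (auto split: split_indicator)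
    have \<psi>i: "integrable lborel \<psi>" unfolding \<psi>_def using gi icube by (intro Bochner_Integration.integrable_diff)
    have \<psi>1: "(\<integral>s. \<psi> s \<partial>lborel) = 1 - ?\<epsilon>"
      unfolding \<psi>_def by (subst Bochner_Integration.integral_diff[OF gi icube]) (simp only: g1 vol)
    have "(\<integral>s. G (x + s) \<partial>N) = (\<integral>s. G (z + s) \<partial>N)"
      by (intro Bochner_Integration.integral_cong refl per) (simp add: z_def floor_vec_lattice)
    also have "\<dots> = (\<integral>s. gauss_density s * G (z + s) \<partial>lborel)"
      unfolding N(2) by (subst integral_density) (auto simp: g0)
    also have "\<dots> = (\<integral>s. gauss_density (s - z) * G s \<partial>lborel)"
      using shift[of "\<lambda>s. gauss_density (s - z) * G s" z] by simp
    also have "\<dots> = (\<integral>s. (\<psi> s * (G s - a) + (?\<epsilon> * indicator ?c s) * (G s - a)) + a * gauss_density (s - z) \<partial>lborel)"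
      by (intro Bochner_Integration.integral_cong refl) (simp add: \<psi>_def algebra_simps)
    also have "\<dots> = (\<integral>s. \<psi> s * (G s - a) \<partial>lborel) + J + a"
      unfolding J_def using Hint[OF \<psi>i] Hint[OF icube] gi g1
      by (simp add: Bochner_Integration.integral_add)
    finally have eq: "(\<integral>s. G (x + s) \<partial>N) = (\<integral>s. \<psi> s * (G s - a) \<partial>lborel) + J + a" .
    have "0 \<le> (\<integral>s. \<psi> s * (G s - a) \<partial>lborel)"
      using \<psi>0 H0 by (intro integral_nonneg_AE) auto
    moreover have "(\<integral>s. \<psi> s * (G s - a) \<partial>lborel) \<le> (\<integral>s. \<psi> s * K \<partial>lborel)"
      using Hint[OF \<psi>i] \<psi>i by (intro integral_mono) (auto simp: \<psi>0 HK mult_left_mono)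
    moreover have "(\<integral>s. \<psi> s * K \<partial>lborel) = (1 - ?\<epsilon>) * K" by (simp add: \<psi>1)
    ultimately show ?thesis unfolding eq by auto
  qed
  show ?thesis using bound[of x] bound[of y] by (simp add: abs_le_iff)
qed

section \<open>Concentration for functionals of block walks\<close>

abbreviation path_space :: "(nat \<Rightarrow> real ^ 'n) measure" where
  "path_space \<equiv> Pi\<^sub>M UNIV (\<lambda>_. borel)"

text \<open>The walk is recorded at times \<open>i / m\<close>.  A path \<open>z\<close> known up to index \<open>j * m\<close> is continued by the
  displacements \<open>\<zeta>\<close> of the next block, measured from the position at index \<open>j * m\<close>.\<close>
definition append_block :: "nat \<Rightarrow> nat \<Rightarrow> (nat \<Rightarrow> real ^ 'n) \<Rightarrow> (nat \<Rightarrow> real ^ 'n) \<Rightarrow> nat \<Rightarrow> real ^ 'n" where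
  "append_block m j z \<zeta> = (\<lambda>i. if i \<le> j * m then z i else z (j * m) + \<zeta> (i - j * m))"

lemma append_block_measurable [measurable]:
  "(\<lambda>x. append_block m j (fst x) (snd x)) \<in> measurable (path_space \<Otimes>\<^sub>M path_space) path_space"
  unfolding append_block_def by (rule measurable_PiM_single') (auto simp: space_PiM)

lemma abs_le_max_abs: "a \<le> x \<and> x \<le> b \<Longrightarrow> \<bar>x :: real\<bar> \<le> max \<bar>a\<bar> \<bar>b\<bar>"
  by auto

lemma (in prob_space) integral_diff_le_const:
  fixes f g :: "'a \<Rightarrow> real"
  assumes "integrable M f" "integrable M g" "\<And>x. \<bar>f x - g x\<bar> \<le> c"
  shows "\<bar>(\<integral>x. f x \<partial>M) - (\<integral>x. g x \<partial>M)\<bar> \<le> c"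
proof -
  have *: "(\<integral>x. u x \<partial>M) \<le> (\<integral>x. v x \<partial>M) + c"
    if "integrable M u" "integrable M v" "\<And>x. \<bar>u x - v x\<bar> \<le> c" for u v :: "'a \<Rightarrow> real"
  proof -
    have "(\<integral>x. u x \<partial>M) \<le> (\<integral>x. v x + c \<partial>M)"
      using that(1,2) that(3)[unfolded abs_le_iff] by (intro integral_mono) (auto simp: algebra_simps)
    then show ?thesis using that(2) by (simp add: prob_space)
  qed
  show ?thesis using *[of f g] *[of g f] assms by (auto simp: abs_le_iff abs_minus_commute)
qed

text \<open>Hoeffding's lemma for a variable whose values lie in an interval of length \<open>L\<close> that need not be
  given explicitly.\<close>
lemma (in prob_space) Hoeffding_range:
  fixes f :: "'a \<Rightarrow> real"
  assumes [measurable]: "f \<in> borel_measurable M" and osc: "\<And>x y. \<bar>f x - f y\<bar> \<le> L" and l: "l > 0"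
  shows "(\<integral>x. exp (l * f x) \<partial>M) \<le> exp (l * (\<integral>x. f x \<partial>M) + l\<^sup>2 * L\<^sup>2 / 8)"
proof -
  define a where "a = Inf (range f)"
  have bdd: "bdd_below (range f)"
    by (rule bdd_belowI2[where m="f undefined - L"]) (use osc in \<open>smt (verit)\<close>)
  have a: "a \<le> f z" for z unfolding a_def using cINF_lower[OF bdd] by simp
  have b: "f z \<le> a + L" for z
  proof -
    have "f z - L \<le> a" unfolding a_def
      using osc[of z] by (intro cINF_greatest) (auto simp: abs_le_iff algebra_simps)
    then show ?thesis by simp
  qed
  interpret interval_bounded_random_variable M f a "a + L"
    by unfold_locales (auto simp: a b)
  have "(\<integral>\<^sup>+x. ennreal (exp (l * (f x - expectation f))) \<partial>M) \<le> ennreal (exp (l\<^sup>2 * (a + L - a)\<^sup>2 / 8))"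
    using Hoeffdings_lemma_nn_integral[OF l] by simp
  moreover have "integrable M (\<lambda>x. exp (l * (f x - expectation f)))"
  proof (rule integrable_const_bound)
    show "AE x in M. norm (exp (l * (f x - expectation f))) \<le> exp (l * (a + L - expectation f))"
      using b l by (auto intro!: AE_I2 mult_left_mono)
  qed measurable
  ultimately have "(\<integral>x. exp (l * (f x - expectation f)) \<partial>M) \<le> exp (l\<^sup>2 * L\<^sup>2 / 8)"
    by (subst (asm) nn_integral_eq_integral) auto
  then have "exp (l * expectation f) * (\<integral>x. exp (l * (f x - expectation f)) \<partial>M)
      \<le> exp (l * expectation f) * exp (l\<^sup>2 * L\<^sup>2 / 8)"
    by (intro mult_left_mono) auto
  also have "exp (l * expectation f) * (\<integral>x. exp (l * (f x - expectation f)) \<partial>M)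
      = (\<integral>x. exp (l * f x) \<partial>M)"
    by (subst integral_mult_right_zero[symmetric]) (simp flip: exp_add add: algebra_simps)
  finally show ?thesis by (simp add: exp_add)
qed

locale block_walk =
  fixes m n :: nat and Q :: "nat \<Rightarrow> (nat \<Rightarrow> real ^ 'n::finite) measure"
  assumes m_pos: "m > 0"
    and prob_Q: "\<And>j. prob_space (Q j)"
    and sets_Q [measurable_cong]: "\<And>j. sets (Q j) = sets path_space"
begin

text \<open>The expectation of \<open>f\<close> of a path whose first \<open>n - k\<close> blocks are those of the argument and whose
  last \<open>k\<close> blocks are drawn independently from \<open>Q (n - k), \<dots>, Q (n - 1)\<close>.  Recursion over the number
  of blocks still to be drawn replaces conditional expectations by iterated integrals.\<close>
primrec cond_exp :: "((nat \<Rightarrow> real ^ 'n) \<Rightarrow> real) \<Rightarrow> nat \<Rightarrow> (nat \<Rightarrow> real ^ 'n) \<Rightarrow> real" where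
  "cond_exp f 0 = f"
| "cond_exp f (Suc k) = (\<lambda>z. \<integral>\<zeta>. cond_exp f k (append_block m (n - Suc k) z \<zeta>) \<partial>Q (n - Suc k))"

lemma cond_exp_measurable [measurable]:
  assumes [measurable]: "f \<in> borel_measurable path_space"
  shows "cond_exp f k \<in> borel_measurable path_space"
proof (induction k)
  case (Suc k)
  note [measurable] = Suc
  interpret Q: prob_space "Q (n - Suc k)" by (rule prob_Q)
  have "(\<lambda>x. cond_exp f k (append_block m (n - Suc k) (fst x) (snd x)))
      \<in> borel_measurable (path_space \<Otimes>\<^sub>M Q (n - Suc k))" by measurable
  then have "case_prod (\<lambda>z \<zeta>. cond_exp f k (append_block m (n - Suc k) z \<zeta>))
      \<in> borel_measurable (path_space \<Otimes>\<^sub>M Q (n - Suc k))" by (simp add: split_beta')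
  then show ?case by (simp add: Q.borel_measurable_lebesgue_integral)
qed (simp add: assms)

lemma append_block_measurable_Q [measurable]:
  "append_block m j z \<in> measurable (Q k) path_space"
  unfolding append_block_def by (rule measurable_PiM_single') (auto simp: space_PiM)

lemma cond_exp_bounds:
  assumes [measurable]: "f \<in> borel_measurable path_space" and f: "\<And>z. a \<le> f z \<and> f z \<le> b"
  shows "a \<le> cond_exp f k z \<and> cond_exp f k z \<le> b"
    and "integrable (Q j) (\<lambda>\<zeta>. cond_exp f k (append_block m i z \<zeta>))"
proof -
  have int: "integrable (Q j) (\<lambda>\<zeta>. cond_exp f k (append_block m i z \<zeta>))"
    if "\<And>z. a \<le> cond_exp f k z \<and> cond_exp f k z \<le> b" for i j k z
  proof -
    interpret prob_space "Q j" by (rule prob_Q)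
    show ?thesis
      using that by (intro integrable_const_bound[where B="max \<bar>a\<bar> \<bar>b\<bar>"]) (auto intro!: AE_I2 abs_le_max_abs)
  qed
  have bd: "a \<le> cond_exp f k z \<and> cond_exp f k z \<le> b" for k z
  proof (induction k arbitrary: z)
    case (Suc k)
    interpret prob_space "Q (n - Suc k)" by (rule prob_Q)
    from int[OF Suc] show ?case
      using Suc by (auto intro!: integral_ge_const integral_le_const)
  qed (use f in simp)
  then show "a \<le> cond_exp f k z \<and> cond_exp f k z \<le> b" by blast
  show "integrable (Q j) (\<lambda>\<zeta>. cond_exp f k (append_block m i z \<zeta>))" by (rule int[OF bd])
qed

text \<open>The iterated integrals compute the expectation along an actual walk: since \<open>\<sigma> j\<close> and \<open>\<zeta> j\<close> are
  independent, the law of the pair is a product, and Fubini's theorem integrates out one block at a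
  time.\<close>
lemma expectation_cond_exp:
  assumes "prob_space M"
    and \<sigma>: "\<And>j. j \<le> n \<Longrightarrow> \<sigma> j \<in> measurable M path_space"
    and \<zeta>: "\<And>j. j < n \<Longrightarrow> \<zeta> j \<in> measurable M path_space"
    and ind: "\<And>j. j < n \<Longrightarrow> prob_space.indep_var M path_space (\<sigma> j) path_space (\<zeta> j)"
    and law: "\<And>j. j < n \<Longrightarrow> distr M path_space (\<zeta> j) = Q j"
    and step: "\<And>j \<omega>. j < n \<Longrightarrow> \<sigma> (Suc j) \<omega> = append_block m j (\<sigma> j \<omega>) (\<zeta> j \<omega>)"
    and [measurable]: "f \<in> borel_measurable path_space" and f: "\<And>z. a \<le> f z \<and> f z \<le> b"
    and "k \<le> n"
  shows "(\<integral>\<omega>. cond_exp f k (\<sigma> (n - k) \<omega>) \<partial>M) = (\<integral>\<omega>. f (\<sigma> n \<omega>) \<partial>M)"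
  using \<open>k \<le> n\<close>
proof (induction k)
  case (Suc k)
  interpret M: prob_space M by fact
  define j where "j = n - Suc k"
  have j: "j < n" "n - k = Suc j" using Suc.prems by (auto simp: j_def)
  note [measurable] = \<sigma>[OF less_imp_le[OF j(1)]] \<zeta>[OF j(1)]
  interpret Q: prob_space "Q j" by (rule prob_Q)
  interpret S: prob_space "distr M path_space (\<sigma> j)" by (rule M.prob_space_distr) simp
  interpret SQ: pair_prob_space "distr M path_space (\<sigma> j)" "Q j" ..
  let ?g = "\<lambda>x. cond_exp f k (append_block m j (fst x) (snd x))"
  have prod: "distr M path_space (\<sigma> j) \<Otimes>\<^sub>M Q j = distr M (path_space \<Otimes>\<^sub>M path_space) (\<lambda>\<omega>. (\<sigma> j \<omega>, \<zeta> j \<omega>))"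
    using ind[OF j(1)] law[OF j(1)] by (simp add: M.indep_var_distribution_eq)
  have gi: "integrable (distr M path_space (\<sigma> j) \<Otimes>\<^sub>M Q j) ?g"
    using cond_exp_bounds(1)[of f a b, OF _ f]
    by (intro SQ.P.integrable_const_bound[where B="max \<bar>a\<bar> \<bar>b\<bar>"]) (auto intro!: AE_I2 abs_le_max_abs)
  have "(\<integral>\<omega>. cond_exp f (Suc k) (\<sigma> (n - Suc k) \<omega>) \<partial>M) = (\<integral>\<omega>. cond_exp f (Suc k) (\<sigma> j \<omega>) \<partial>M)"
    by (simp only: j_def)
  also have "\<dots> = (\<integral>z. cond_exp f (Suc k) z \<partial>distr M path_space (\<sigma> j))"
    by (rule integral_distr[symmetric]) (auto simp del: cond_exp.simps)
  also have "\<dots> = (\<integral>z. (\<integral>y. ?g (z, y) \<partial>Q j) \<partial>distr M path_space (\<sigma> j))"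
    by (simp add: j_def)
  also have "\<dots> = (\<integral>x. ?g x \<partial>(distr M path_space (\<sigma> j) \<Otimes>\<^sub>M Q j))"
    by (rule SQ.integral_fst'[OF gi])
  also have "\<dots> = (\<integral>\<omega>. cond_exp f k (append_block m j (\<sigma> j \<omega>) (\<zeta> j \<omega>)) \<partial>M)"
    unfolding prod by (subst integral_distr) auto
  also have "\<dots> = (\<integral>\<omega>. cond_exp f k (\<sigma> (n - k) \<omega>) \<partial>M)"
    by (simp add: step[OF j(1)] j(2))
  finally show ?case using Suc by simp
qed simp

end

text \<open>The assumptions \<open>F_block\<close> and \<open>contracts\<close> are the Lipschitz property in total variation and the
  mixing property.  Here \<open>\<zeta> m\<close> is the total displacement over a block.\<close>
locale mixing_block_walk = block_walk m n Q
  for m n :: nat and Q :: "nat \<Rightarrow> (nat \<Rightarrow> real ^ 'n::finite) measure" +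
  fixes F :: "(nat \<Rightarrow> real ^ 'n) \<Rightarrow> real" and C e a b :: real
  assumes n_pos: "n > 0"
    and F_measurable [measurable]: "F \<in> borel_measurable path_space"
    and F_bounds: "\<And>z. a \<le> F z \<and> F z \<le> b"
    and F_periodic: "\<And>z z'. (\<And>i. z i - z' i \<in> int_lattice) \<Longrightarrow> F z = F z'"
    and F_block: "\<And>l z z'. l < n \<Longrightarrow> (\<And>i. i < n * m \<Longrightarrow> i \<notin> {l * m..<Suc l * m} \<Longrightarrow> z i = z' i)
        \<Longrightarrow> \<bar>F z - F z'\<bar> \<le> C"
    and e: "0 < e" "e \<le> 1"
    and contracts: "\<And>G x y K j. G \<in> borel_measurable borel \<Longrightarrow>
        (\<And>x y. x - y \<in> int_lattice \<Longrightarrow> G x = G y) \<Longrightarrow> (\<And>x y. \<bar>G x - G y\<bar> \<le> K) \<Longrightarrow>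
        \<bar>(\<integral>\<zeta>. G (x + \<zeta> m) \<partial>Q j) - (\<integral>\<zeta>. G (y + \<zeta> m) \<partial>Q j)\<bar> \<le> (1 - e) * K"
begin

definition V :: "nat \<Rightarrow> (nat \<Rightarrow> real ^ 'n) \<Rightarrow> real" where
  "V = cond_exp F"

lemma V_0: "V 0 = F" by (simp add: V_def)

lemma V_Suc: "V (Suc k) z = (\<integral>\<zeta>. V k (append_block m (n - Suc k) z \<zeta>) \<partial>Q (n - Suc k))"
  by (simp add: V_def)

lemma V_measurable [measurable]: "V k \<in> borel_measurable path_space"
  unfolding V_def by measurable

lemma V_integrable: "integrable (Q j) (\<lambda>\<zeta>. V k (append_block m i z \<zeta>))"
  unfolding V_def by (rule cond_exp_bounds(2)[OF F_measurable F_bounds])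

lemma V_bounds: "a \<le> V k z \<and> V k z \<le> b"
  unfolding V_def by (rule cond_exp_bounds(1)[OF F_measurable F_bounds])

lemma C_nonneg: "0 \<le> C"
  using F_block[OF n_pos, of "\<lambda>_. 0" "\<lambda>_. 0"] by simp

lemma V_periodic: "(\<And>i. z i - z' i \<in> int_lattice) \<Longrightarrow> V k z = V k z'"
proof (induction k arbitrary: z z')
  case 0
  then show ?case unfolding V_0 by (rule F_periodic)
next
  case (Suc k)
  show ?case unfolding V_Suc
    by (intro Bochner_Integration.integral_cong refl Suc.IH) (auto simp: append_block_def Suc.prems)
qed

text \<open>A block that is entirely in the past and does not affect the current position enters only
  through \<open>F\<close>.\<close>
lemma V_block:
  assumes "k \<le> n" "l < n - k"
    and "\<And>i. i \<le> (n - k) * m \<Longrightarrow> i \<notin> {l * m..<Suc l * m} \<Longrightarrow> z i = z' i"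
  shows "\<bar>V k z - V k z'\<bar> \<le> C"
  using assms
proof (induction k arbitrary: z z')
  case 0
  show ?case unfolding V_0 using 0 by (intro F_block[of l]) auto
next
  case (Suc k)
  define j where "j = n - Suc k"
  have j: "n - k = Suc j" "l < j" using Suc.prems by (auto simp: j_def)
  have l: "Suc l * m \<le> j * m" using j(2) by (intro mult_le_mono1) simp
  interpret prob_space "Q j" by (rule prob_Q)
  have same: "z i = z' i" if "i \<le> j * m" "i \<notin> {l * m..<Suc l * m}" for i
    using Suc.prems(3)[of i] that by (simp add: j_def)
  have "\<bar>V k (append_block m j z \<zeta>) - V k (append_block m j z' \<zeta>)\<bar> \<le> C" for \<zeta>
  proof (rule Suc.IH)
    fix i assume "i \<notin> {l * m..<Suc l * m}"
    then show "append_block m j z \<zeta> i = append_block m j z' \<zeta> i"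
      using same[of i] same[of "j * m"] l by (auto simp: append_block_def)
  qed (use Suc.prems j in auto)
  then show ?case unfolding V_Suc j_def[symmetric]
    by (intro integral_diff_le_const V_integrable)
qed

text \<open>The solution of \<open>K = 2 * C + (1 - e) * K\<close>: it bounds the influence of the current position on the
  expected future, uniformly in the remaining time.\<close>
definition K :: real where "K = 2 * C / e"

lemma C_le_K: "C \<le> K"
proof -
  have "C * e \<le> C * 1" using C_nonneg e by (intro mult_left_mono) auto
  then have "C * e \<le> 2 * C" using C_nonneg by simp
  then show ?thesis using e by (simp add: K_def pos_le_divide_eq)
qed

text \<open>Two starting positions are compared over one further block.  Freezing the path inside that block
  costs \<open>C\<close> for each of them; what remains is the average of a periodic function of the end position,
  whose oscillation is at most \<open>K\<close> by induction and is contracted by the Gaussian step.\<close>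
lemma V_restart:
  assumes "k \<le> n" "\<And>i. i < (n - k) * m \<Longrightarrow> z i = z' i"
  shows "\<bar>V k z - V k z'\<bar> \<le> K"
  using assms
proof (induction k arbitrary: z z')
  case 0
  have "\<bar>F z - F z'\<bar> \<le> C" using 0 n_pos by (intro F_block[of 0]) auto
  then show ?case unfolding V_0 using C_le_K by linarith
next
  case (Suc k)
  define j where "j = n - Suc k"
  have j: "n - k = Suc j" "j < n" using Suc.prems by (auto simp: j_def)
  interpret prob_space "Q j" by (rule prob_Q)
  have same: "z i = z' i" if "i < j * m" for i
    using Suc.prems(2)[of i] that by (simp add: j_def)
  \<comment> \<open>The path with the current block replaced by an arbitrary fixed value and then resting at y.\<close>
  define frozen where "frozen y i = (if i < j * m then z i else if i < Suc j * m then 0 else y)" for y i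
  define G where "G y = V k (frozen y)" for y
  have [measurable]: "frozen \<in> measurable borel path_space"
    unfolding frozen_def by (rule measurable_PiM_single') (auto simp: space_PiM)
  have G[measurable]: "G \<in> borel_measurable borel" unfolding G_def by measurable
  have G_per: "G x = G y" if "x - y \<in> int_lattice" for x y
    unfolding G_def by (rule V_periodic) (use that in \<open>auto simp: frozen_def\<close>)
  have G_osc: "\<bar>G x - G y\<bar> \<le> K" for x y
    unfolding G_def using Suc.prems(1) by (intro Suc.IH) (auto simp: frozen_def j)
  have G_bd: "a \<le> G y \<and> G y \<le> b" for y unfolding G_def by (rule V_bounds)
  have Gint: "integrable (Q j) (\<lambda>\<zeta>. G (x + \<zeta> m))" for x
  proof -
    have "(\<lambda>\<zeta>. \<zeta> m) \<in> measurable (Q j) borel" by measurable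
    then show ?thesis
      using G_bd by (intro integrable_const_bound[where B="max \<bar>a\<bar> \<bar>b\<bar>"]) (auto intro!: AE_I2 abs_le_max_abs)
  qed
  have close: "\<bar>V k (append_block m j w \<zeta>) - G (w (j * m) + \<zeta> m)\<bar> \<le> C"
    if "\<And>i. i < j * m \<Longrightarrow> w i = z i" for w \<zeta>
    unfolding G_def
  proof (rule V_block[of k j])
    fix i assume i: "i \<le> (n - k) * m" "i \<notin> {j * m..<Suc j * m}"
    show "append_block m j w \<zeta> i = frozen (w (j * m) + \<zeta> m) i"
    proof (cases "i < j * m")
      case True
      then show ?thesis using that by (simp add: append_block_def frozen_def)
    next
      case False
      with i have "i = Suc j * m" unfolding j by simp
      then show ?thesis using m_pos by (simp add: append_block_def frozen_def)
    qed
  qed (use Suc.prems j in auto)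
  have 1: "\<bar>V (Suc k) w - (\<integral>\<zeta>. G (w (j * m) + \<zeta> m) \<partial>Q j)\<bar> \<le> C"
    if "\<And>i. i < j * m \<Longrightarrow> w i = z i" for w
    unfolding V_Suc j_def[symmetric]
    by (intro integral_diff_le_const V_integrable Gint close that)
  have "\<bar>(\<integral>\<zeta>. G (z (j * m) + \<zeta> m) \<partial>Q j) - (\<integral>\<zeta>. G (z' (j * m) + \<zeta> m) \<partial>Q j)\<bar> \<le> (1 - e) * K"
    by (rule contracts[OF G G_per G_osc])
  then have "\<bar>V (Suc k) z - V (Suc k) z'\<bar> \<le> 2 * C + (1 - e) * K"
    using 1[of z] 1[of z'] same by (simp add: abs_le_iff)
  also have "\<dots> = K" using e by (simp add: K_def field_simps)
  finally show ?case .
qed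

text \<open>The martingale differences are bounded: a new block acts through its interior, at a cost of
  \<open>C\<close>, and through its end position, at a cost of \<open>K\<close>.\<close>
lemma V_append_osc:
  assumes "Suc k \<le> n"
  shows "\<bar>V k (append_block m (n - Suc k) z \<zeta>) - V k (append_block m (n - Suc k) z \<zeta>')\<bar> \<le> C + K"
proof -
  define j where "j = n - Suc k"
  have j: "n - k = Suc j" "j < n" using assms by (auto simp: j_def)
  let ?x = "append_block m j z \<zeta>" and ?y = "append_block m j z \<zeta>'"
  \<comment> \<open>An intermediate path: the block interior of the first continuation, the end of the second.\<close>
  define w where "w i = (if i < Suc j * m then ?x i else ?y i)" for i
  have "\<bar>V k ?x - V k w\<bar> \<le> K"
    using assms by (intro V_restart) (auto simp: w_def j)
  moreover have "\<bar>V k w - V k ?y\<bar> \<le> C"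
  proof (rule V_block[of k j])
    fix i assume i: "i \<notin> {j * m..<Suc j * m}"
    show "w i = ?y i"
    proof (cases "i < j * m")
      case True
      then have "i < Suc j * m" by simp
      with True show ?thesis by (simp add: w_def append_block_def)
    next
      case False
      with i have "\<not> i < Suc j * m" by simp
      then show ?thesis by (simp add: w_def)
    qed
  qed (use assms j in auto)
  ultimately show ?thesis unfolding j_def[symmetric] by linarith
qed

text \<open>Each block costs one application of Hoeffding's lemma, because the conditional expectation
  \<open>V\<close> varies over an interval of length \<open>C + K\<close> when only the new block varies.\<close>
lemma exponential_step:
  assumes l: "l > 0" and "k \<le> n"
  shows "cond_exp (\<lambda>z. exp (l * F z)) k z \<le> exp (l * V k z + k * (l\<^sup>2 * (C + K)\<^sup>2 / 8))"
  using \<open>k \<le> n\<close>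
proof (induction k arbitrary: z)
  case (Suc k)
  define j where "j = n - Suc k"
  interpret prob_space "Q j" by (rule prob_Q)
  let ?c = "l\<^sup>2 * (C + K)\<^sup>2 / 8"
  have bds: "exp (l * a) \<le> exp (l * F z) \<and> exp (l * F z) \<le> exp (l * b)" for z
    using F_bounds l by simp
  have 1: "integrable (Q j) (\<lambda>\<zeta>. exp (l * V k (append_block m j z \<zeta>)))"
    using V_bounds l by (intro integrable_const_bound[where B="exp (l * b)"]) (auto intro!: AE_I2)
  have "cond_exp (\<lambda>z. exp (l * F z)) (Suc k) z
      = (\<integral>\<zeta>. cond_exp (\<lambda>z. exp (l * F z)) k (append_block m j z \<zeta>) \<partial>Q j)"
    by (simp add: j_def)
  also have "\<dots> \<le> (\<integral>\<zeta>. exp (k * ?c) * exp (l * V k (append_block m j z \<zeta>)) \<partial>Q j)"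
  proof (rule integral_mono)
    show "integrable (Q j) (\<lambda>\<zeta>. cond_exp (\<lambda>z. exp (l * F z)) k (append_block m j z \<zeta>))"
      by (rule cond_exp_bounds(2)[OF _ bds]) measurable
    show "cond_exp (\<lambda>z. exp (l * F z)) k (append_block m j z \<zeta>)
        \<le> exp (k * ?c) * exp (l * V k (append_block m j z \<zeta>))" for \<zeta>
      using Suc.IH[of "append_block m j z \<zeta>"] Suc.prems by (simp add: exp_add mult.commute)
  qed (use 1 in simp)
  also have "\<dots> = exp (k * ?c) * (\<integral>\<zeta>. exp (l * V k (append_block m j z \<zeta>)) \<partial>Q j)" by simp
  also have "\<dots> \<le> exp (k * ?c) * exp (l * (\<integral>\<zeta>. V k (append_block m j z \<zeta>) \<partial>Q j) + ?c)"
    using V_append_osc[OF Suc.prems] l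
    by (intro mult_left_mono Hoeffding_range) (auto simp: j_def)
  also have "\<dots> = exp (l * V (Suc k) z + Suc k * ?c)"
    unfolding V_Suc j_def[symmetric] by (simp add: exp_add[symmetric] algebra_simps)
  finally show ?case .
qed (simp add: V_0)

text \<open>Azuma's inequality for a walk realised on \<open>M\<close>.  The summand \<open>l * K\<close> accounts for the random
  starting point, the other one for the \<open>n\<close> blocks.\<close>
lemma exponential_moment:
  assumes M: "prob_space M"
    and \<sigma>: "\<And>j. j \<le> n \<Longrightarrow> \<sigma> j \<in> measurable M path_space"
    and \<zeta>: "\<And>j. j < n \<Longrightarrow> \<zeta> j \<in> measurable M path_space"
    and ind: "\<And>j. j < n \<Longrightarrow> prob_space.indep_var M path_space (\<sigma> j) path_space (\<zeta> j)"
    and law: "\<And>j. j < n \<Longrightarrow> distr M path_space (\<zeta> j) = Q j"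
    and step: "\<And>j \<omega>. j < n \<Longrightarrow> \<sigma> (Suc j) \<omega> = append_block m j (\<sigma> j \<omega>) (\<zeta> j \<omega>)"
    and l: "l > 0"
  shows "(\<integral>\<omega>. exp (l * (F (\<sigma> n \<omega>) - (\<integral>\<omega>. F (\<sigma> n \<omega>) \<partial>M))) \<partial>M)
      \<le> exp (l * K + n * (l\<^sup>2 * (C + K)\<^sup>2 / 8))"
proof -
  interpret M: prob_space M by fact
  let ?c = "n * (l\<^sup>2 * (C + K)\<^sup>2 / 8)"
  let ?E = "\<integral>\<omega>. F (\<sigma> n \<omega>) \<partial>M"
  note [measurable] = \<sigma>[OF le0] \<sigma>[OF order.refl]
  have bds: "exp (l * a) \<le> exp (l * F z) \<and> exp (l * F z) \<le> exp (l * b)" for z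
    using F_bounds l by simp
  have mexp[measurable]: "(\<lambda>z. exp (l * F z)) \<in> borel_measurable path_space" by measurable
  have EV: "(\<integral>\<omega>. V n (\<sigma> 0 \<omega>) \<partial>M) = ?E"
    using expectation_cond_exp[where \<sigma> = \<sigma> and \<zeta> = \<zeta> and k = n, OF M \<sigma> \<zeta> ind law step F_measurable F_bounds]
    by (simp add: V_def)
  have EU: "(\<integral>\<omega>. cond_exp (\<lambda>z. exp (l * F z)) n (\<sigma> 0 \<omega>) \<partial>M) = (\<integral>\<omega>. exp (l * F (\<sigma> n \<omega>)) \<partial>M)"
    using expectation_cond_exp[where \<sigma> = \<sigma> and \<zeta> = \<zeta> and k = n, OF M \<sigma> \<zeta> ind law step mexp bds] by simp
  have Vint: "integrable M (\<lambda>\<omega>. V n (\<sigma> 0 \<omega>))"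
    using V_bounds by (intro M.integrable_const_bound[where B="max \<bar>a\<bar> \<bar>b\<bar>"]) (auto intro!: AE_I2 abs_le_max_abs)
  \<comment> \<open>The starting point shifts the expected value by at most K.\<close>
  have VE: "V n (\<sigma> 0 \<omega>) \<le> ?E + K" for \<omega>
  proof -
    have "V n (\<sigma> 0 \<omega>) - K \<le> V n (\<sigma> 0 \<omega>')" for \<omega>'
      using V_restart[of n "\<sigma> 0 \<omega>" "\<sigma> 0 \<omega>'"] by (simp add: abs_le_iff)
    then have "V n (\<sigma> 0 \<omega>) - K \<le> (\<integral>\<omega>. V n (\<sigma> 0 \<omega>) \<partial>M)"
      using Vint by (intro M.integral_ge_const) auto
    then show ?thesis by (simp add: EV)
  qed
  have le: "cond_exp (\<lambda>z. exp (l * F z)) n (\<sigma> 0 \<omega>) \<le> exp (l * ?E + (l * K + ?c))" for \<omega>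
  proof -
    have "cond_exp (\<lambda>z. exp (l * F z)) n (\<sigma> 0 \<omega>) \<le> exp (l * V n (\<sigma> 0 \<omega>) + ?c)"
      by (rule exponential_step[OF l order.refl])
    also have "\<dots> \<le> exp (l * (?E + K) + ?c)"
      using VE[of \<omega>] l by simp
    finally show ?thesis by (simp add: algebra_simps)
  qed
  have [measurable]: "(\<lambda>\<omega>. cond_exp (\<lambda>z. exp (l * F z)) n (\<sigma> 0 \<omega>)) \<in> borel_measurable M"
    by (rule measurable_compose[OF \<sigma>[OF le0] cond_exp_measurable[OF mexp]])
  have int: "integrable M (\<lambda>\<omega>. cond_exp (\<lambda>z. exp (l * F z)) n (\<sigma> 0 \<omega>))"
  proof (rule M.integrable_const_bound)
    have "norm (cond_exp (\<lambda>z. exp (l * F z)) n (\<sigma> 0 \<omega>)) \<le> exp (l * b)" for \<omega>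
      using cond_exp_bounds(1)[OF mexp bds, of n "\<sigma> 0 \<omega>"] exp_gt_zero[of "l * a"]
      unfolding real_norm_def by linarith
    then show "AE \<omega> in M. norm (cond_exp (\<lambda>z. exp (l * F z)) n (\<sigma> 0 \<omega>)) \<le> exp (l * b)" by simp
  qed measurable
  have "(\<integral>\<omega>. cond_exp (\<lambda>z. exp (l * F z)) n (\<sigma> 0 \<omega>) \<partial>M) \<le> exp (l * ?E + (l * K + ?c))"
    using le by (intro M.integral_le_const[OF int]) simp
  then have "exp (- l * ?E) * (\<integral>\<omega>. exp (l * F (\<sigma> n \<omega>)) \<partial>M) \<le> exp (- l * ?E) * exp (l * ?E + (l * K + ?c))"
    unfolding EU by (intro mult_left_mono) auto
  also have "exp (- l * ?E) * (\<integral>\<omega>. exp (l * F (\<sigma> n \<omega>)) \<partial>M)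
      = (\<integral>\<omega>. exp (l * (F (\<sigma> n \<omega>) - ?E)) \<partial>M)"
    by (subst integral_mult_right_zero[symmetric]) (simp flip: exp_add add: algebra_simps)
  finally show ?thesis by (simp flip: exp_add)
qed

end

section \<open>Brownian motion sampled on a grid\<close>

definition grid_path :: "nat \<Rightarrow> (nat \<Rightarrow> real ^ 'n::finite) \<Rightarrow> real \<Rightarrow> 'n torus" where
  "grid_path m z t = torus_proj (z (nat \<lfloor>t * real m\<rfloor>))"

definition grid_cost :: "real \<Rightarrow> nat \<Rightarrow> nat \<Rightarrow> (nat \<Rightarrow> real ^ 'n::finite) \<Rightarrow> real" where
  "grid_cost p m n z = occ_cost p (real n) (grid_path m z)"

lemma grid_path_measurable [measurable]: "grid_path m z \<in> borel_measurable borel"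
proof -
  have "(\<lambda>t. nat \<lfloor>t * real m\<rfloor>) \<in> measurable borel (count_space UNIV)" by measurable
  then show ?thesis unfolding grid_path_def by (rule measurable_compose) simp
qed

lemma grid_path_measurable_time_interval: "grid_path m z \<in> borel_measurable (time_interval T)"
  by (rule measurable_restrict_space1) simp

lemma grid_cost_periodic:
  "(\<And>i. z i - z' i \<in> int_lattice) \<Longrightarrow> grid_cost p m n z = grid_cost p m n z'"
  unfolding grid_cost_def grid_path_def by (intro occ_cost_cong) (simp add: torus_proj_eq_iff)

lemma grid_cost_bounds:
  fixes z :: "nat \<Rightarrow> real ^ 'n::finite"
  shows "p > 0 \<Longrightarrow> 0 \<le> grid_cost p m n z \<and> grid_cost p m n z \<le> cost_bound TYPE('n) p * n"
  unfolding grid_cost_def by (intro conjI occ_cost_nonneg occ_cost_le grid_path_measurable_time_interval) auto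

text \<open>The grid indices of a block fill a time interval of length one.  The final instant \<open>n\<close>, where
  the index \<open>n * m\<close> beyond the last block is read, is a null set.\<close>
lemma grid_cost_block:
  fixes z z' :: "nat \<Rightarrow> real ^ 'n::finite"
  assumes p: "p > 0" and m: "m > 0" and l: "l < n"
    and z: "\<And>i. i < n * m \<Longrightarrow> i \<notin> {l * m..<Suc l * m} \<Longrightarrow> z i = z' i"
  shows "\<bar>grid_cost p m n z - grid_cost p m n z'\<bar> \<le> cost_bound TYPE('n) p"
proof -
  \<comment> \<open>The closed unit interval of the block, together with the final instant.\<close>
  define A where "A = {real l..real (Suc l)} \<union> {real n}"
  have A: "A \<in> sets (time_interval (real n))" "A \<in> sets borel" "A \<subseteq> {0..real n}"
    using l by (auto simp: A_def sets_restrict_space_iff)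
  have "measure (time_interval (real n)) A = measure lborel A"
    using A by (intro measure_restrict_space) auto
  also have "\<dots> \<le> measure lborel {real l..real (Suc l)} + measure lborel {real n}"
    unfolding A_def by (intro measure_Un_le) auto
  also have "\<dots> = 1" by (simp add: measure_def)
  finally have mA: "measure (time_interval (real n)) A \<le> 1" .
  have "\<bar>grid_cost p m n z - grid_cost p m n z'\<bar>
      \<le> 0 * real n + cost_bound TYPE('n) p * measure (time_interval (real n)) A"
    unfolding grid_cost_def
  proof (rule occ_cost_close[OF p])
    fix t and y :: "'n torus" assume t: "t \<in> {0..real n} - A"
    define i where "i = nat \<lfloor>t * real m\<rfloor>"
    have t0: "0 \<le> t" "t < real n" "\<not> (real l \<le> t \<and> t \<le> real (Suc l))" using t by (auto simp: A_def)
    have i: "real i \<le> t * real m" "t * real m < real i + 1"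
    proof -
      have "real i = of_int \<lfloor>t * real m\<rfloor>" using t0(1) by (simp add: i_def)
      then show "real i \<le> t * real m" "t * real m < real i + 1" by linarith+
    qed
    have "real i < real n * real m"
      using i(1) mult_strict_right_mono[OF t0(2), of "real m"] m by linarith
    then have in_: "i < n * m" by (simp flip: of_nat_mult)
    have "i \<notin> {l * m..<Suc l * m}"
    proof
      assume "i \<in> {l * m..<Suc l * m}"
      then have "real (l * m) \<le> real i" "real (i + 1) \<le> real (Suc l * m)" by (simp_all only: of_nat_le_iff) auto
      then have "real l * real m \<le> t * real m" "t * real m \<le> real (Suc l) * real m"
        using i by (simp_all only: of_nat_mult of_nat_add of_nat_1)
      then have "real l \<le> t \<and> t \<le> real (Suc l)" using m by (simp only: mult_le_cancel_right_pos of_nat_0_less_iff)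
      with t0(3) show False by blast
    qed
    from z[OF in_ this] show "\<bar>dist (grid_path m z t) y powr p - dist (grid_path m z' t) y powr p\<bar> \<le> 0"
      by (simp add: grid_path_def i_def)
  qed (use A in \<open>auto intro: grid_path_measurable_time_interval\<close>)
  also have "\<dots> \<le> cost_bound TYPE('n) p * 1"
    using mA mult_left_mono[OF mA cost_bound_nonneg] by simp
  finally show ?thesis by simp
qed

text \<open>The cost is an infimum over an uncountable set of plans, so measurability is obtained from
  continuity in the finitely many grid positions that matter.\<close>
lemma grid_cost_measurable:
  assumes p: "p > 0"
  shows "grid_cost p m n \<in> borel_measurable (path_space :: (nat \<Rightarrow> real ^ 'n::finite) measure)"
proof -
  have "continuous_on UNIV (grid_cost p m n :: (nat \<Rightarrow> real ^ 'n) \<Rightarrow> real)"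
  proof (subst continuous_on_eq_continuous_at[OF open_UNIV], intro ballI)
    fix z :: "nat \<Rightarrow> real ^ 'n"
    show "isCont (grid_cost p m n) z"
      unfolding isCont_def
    proof (rule tendstoI)
      fix \<epsilon> :: real assume \<epsilon>: "\<epsilon> > 0"
      define \<eta> where "\<eta> = \<epsilon> / (real n + 1)"
      have \<eta>: "\<eta> > 0" "\<eta> * real n < \<epsilon>" using \<epsilon> by (auto simp: \<eta>_def field_simps)
      obtain \<delta> where \<delta>: "\<delta> > 0"
        "\<And>x x' y :: 'n torus. dist x x' < \<delta> \<Longrightarrow> \<bar>dist x y powr p - dist x' y powr p\<bar> \<le> \<eta>"
        using dist_powr_diff_modulus[OF p \<eta>(1)] by metis
      have "\<forall>\<^sub>F w in at z. \<forall>i\<in>{..n * m}. dist (w i) (z i) < \<delta>"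
      proof (rule eventually_ball_finite[OF finite_atMost], intro ballI)
        fix i
        have "isCont (\<lambda>w :: nat \<Rightarrow> real ^ 'n. w i) z"
          by (rule continuous_on_interior[OF continuous_on_product_coordinates]) simp
        then show "\<forall>\<^sub>F w in at z. dist (w i) (z i) < \<delta>"
          using \<delta>(1) by (auto simp: isCont_def dest: tendstoD)
      qed
      then show "\<forall>\<^sub>F w in at z. dist (grid_cost p m n w) (grid_cost p m n z) < \<epsilon>"
      proof eventually_elim
        case (elim w)
        have "\<bar>grid_cost p m n w - grid_cost p m n z\<bar>
            \<le> \<eta> * real n + cost_bound TYPE('n) p * measure (time_interval (real n)) {}"
          unfolding grid_cost_def
        proof (rule occ_cost_close[OF p])
          fix t and y :: "'n torus" assume t: "t \<in> {0..real n} - {}"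
          have "t * real m \<le> real (n * m)" using t by (simp add: mult_right_mono)
          then have "nat \<lfloor>t * real m\<rfloor> \<le> n * m"
            by (metis floor_mono floor_of_nat nat_int nat_mono)
          then have "dist (w (nat \<lfloor>t * real m\<rfloor>)) (z (nat \<lfloor>t * real m\<rfloor>)) < \<delta>" using elim by simp
          then show "\<bar>dist (grid_path m w t) y powr p - dist (grid_path m z t) y powr p\<bar> \<le> \<eta>"
            unfolding grid_path_def by (intro \<delta>(2) order.strict_trans1[OF dist_torus_proj_le])
        qed (use \<eta> in \<open>auto intro: grid_path_measurable_time_interval\<close>)
        then show ?case using \<eta>(2) by (simp add: dist_real_def)
      qed
    qed
  qed
  then have "grid_cost p m n \<in> borel_measurable (borel :: (nat \<Rightarrow> real ^ 'n) measure)"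
    by (rule borel_measurable_continuous_onI)
  then show ?thesis
    by (subst measurable_cong_sets[OF sets_PiM_equal_borel refl])
qed

lemma doeblin_const_le_1: "doeblin_const TYPE('n::finite) \<le> 1"
proof -
  have "1 \<le> sqrt (2 * pi)" using pi_gt3 by (intro real_le_rsqrt) simp
  then have "normal_density 0 1 1 \<le> 1" by (simp add: normal_density_def divide_simps mult_le_one order.trans[OF _ \<open>1 \<le> sqrt (2 * pi)\<close>])
  then show ?thesis unfolding doeblin_const_def by (intro power_le_one) auto
qed

text \<open>Both the path up to the \<open>j\<close>-th block and the displacements inside that block are partial sums of
  grid increments, over disjoint sets of indices.\<close>
lemma brownian_motion_block_indep:
  fixes X :: "real \<Rightarrow> 'w \<Rightarrow> real ^ 'n::finite"
  assumes bm: "brownian_motion M X" and m: "m > 0"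
  defines "\<sigma> \<equiv> \<lambda>j \<omega> i. X (real (min i (j * m)) / real m) \<omega>"
    and "\<zeta> \<equiv> \<lambda>j \<omega> i. X (real (j * m + min i m) / real m) \<omega> - X (real (j * m) / real m) \<omega>"
  shows "\<sigma> j \<in> measurable M path_space" "\<zeta> j \<in> measurable M path_space"
    "prob_space.indep_var M path_space (\<sigma> j) path_space (\<zeta> j)"
    "\<sigma> (Suc j) \<omega> = append_block m j (\<sigma> j \<omega>) (\<zeta> j \<omega>)"
proof -
  interpret prob_space M using bm by (simp add: brownian_motion_def)
  have X[measurable]: "X t \<in> borel_measurable M" if "t \<ge> 0" for t
    using bm that by (simp add: brownian_motion_def)
  show \<sigma>: "\<sigma> j \<in> measurable M path_space" for j
    unfolding \<sigma>_def by (rule measurable_PiM_single') (auto simp: space_PiM)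
  show \<zeta>: "\<zeta> j \<in> measurable M path_space"
    unfolding \<zeta>_def by (rule measurable_PiM_single') (auto simp: space_PiM)
  show "\<sigma> (Suc j) \<omega> = append_block m j (\<sigma> j \<omega>) (\<zeta> j \<omega>)"
    by (rule ext) (auto simp: append_block_def \<sigma>_def \<zeta>_def min_def add.commute)
  define t where "t k = real k / real m" for k
  define D where "D k \<omega> = (case k of 0 \<Rightarrow> X 0 \<omega> | Suc j \<Rightarrow> X (t (Suc j)) \<omega> - X (t j) \<omega>)" for k \<omega>
  have "t 0 = 0 \<and> mono t" by (auto simp: t_def mono_def divide_right_mono)
  then have "indep_vars (\<lambda>_. borel) D UNIV"
    using bm unfolding brownian_motion_def D_def by blast
  then have ind: "indep_var (PiM {..j * m} (\<lambda>_. borel)) (\<lambda>\<omega>. restrict (\<lambda>i. D i \<omega>) {..j * m})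
      (PiM {j * m<..j * m + m} (\<lambda>_. borel)) (\<lambda>\<omega>. restrict (\<lambda>i. D i \<omega>) {j * m<..j * m + m})"
    by (rule indep_var_restrict) auto
  have tel: "(\<Sum>k\<le>i. D k \<omega>) = X (t i) \<omega>" for i \<omega>
    by (induction i) (auto simp: D_def t_def)
  have tel2: "(\<Sum>k\<in>{a<..a + i}. D k \<omega>) = X (t (a + i)) \<omega> - X (t a) \<omega>" for a i \<omega>
  proof (induction i)
    case (Suc i)
    have "{a<..a + Suc i} = insert (Suc (a + i)) {a<..a + i}" by auto
    then show ?case using Suc by (simp add: D_def)
  qed simp
  define Y1 where "Y1 w i = (\<Sum>k\<le>min i (j * m). w k)" for w :: "nat \<Rightarrow> real ^ 'n" and i
  define Y2 where "Y2 w i = (\<Sum>k\<in>{j * m<..j * m + min i m}. w k)" for w :: "nat \<Rightarrow> real ^ 'n" and i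
  have "Y1 \<in> measurable (PiM {..j * m} (\<lambda>_. borel)) path_space"
    unfolding Y1_def by (rule measurable_PiM_single') (auto simp: space_PiM intro!: borel_measurable_sum)
  moreover have "Y2 \<in> measurable (PiM {j * m<..j * m + m} (\<lambda>_. borel)) path_space"
    unfolding Y2_def by (rule measurable_PiM_single') (auto simp: space_PiM intro!: borel_measurable_sum)
  ultimately have "indep_var path_space (Y1 \<circ> (\<lambda>\<omega>. restrict (\<lambda>i. D i \<omega>) {..j * m}))
      path_space (Y2 \<circ> (\<lambda>\<omega>. restrict (\<lambda>i. D i \<omega>) {j * m<..j * m + m}))"
    by (rule indep_var_compose[OF ind])
  moreover have "Y1 \<circ> (\<lambda>\<omega>. restrict (\<lambda>i. D i \<omega>) {..j * m}) = \<sigma> j"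
    by (intro ext) (simp add: Y1_def \<sigma>_def tel t_def)
  moreover have "Y2 \<circ> (\<lambda>\<omega>. restrict (\<lambda>i. D i \<omega>) {j * m<..j * m + m}) = \<zeta> j"
  proof (intro ext)
    fix \<omega> i
    have "(Y2 \<circ> (\<lambda>\<omega>. restrict (\<lambda>i. D i \<omega>) {j * m<..j * m + m})) \<omega> i
        = (\<Sum>k\<in>{j * m<..j * m + min i m}. D k \<omega>)"
      unfolding Y2_def comp_def by (intro sum.cong) auto
    then show "(Y2 \<circ> (\<lambda>\<omega>. restrict (\<lambda>i. D i \<omega>) {j * m<..j * m + m})) \<omega> i = \<zeta> j \<omega> i"
      by (simp add: tel2 \<zeta>_def t_def)
  qed
  ultimately show "indep_var path_space (\<sigma> j) path_space (\<zeta> j)" by simp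
qed


text \<open>The bound on the martingale differences of the transport cost.  Its independence of the mesh and of
  the time horizon is what makes the limit \<open>m \<rightarrow> \<infinity>\<close> and the \<open>\<surd>T\<close> scale possible.\<close>
definition block_range :: "'n::finite itself \<Rightarrow> real \<Rightarrow> real" where
  "block_range _ p = cost_bound TYPE('n) p + 2 * cost_bound TYPE('n) p / doeblin_const TYPE('n)"

lemma grid_cost_exponential_moment:
  fixes X :: "real \<Rightarrow> 'w \<Rightarrow> real ^ 'n::finite"
  assumes bm: "brownian_motion M X" and p: "p > 0" and m: "m > 0" and n: "n > 0"
    and l: "l > 0" and s: "s = 1 \<or> s = -1"
  defines "Y \<equiv> \<lambda>\<omega>. s * grid_cost p m n (\<lambda>i. X (real (min i (n * m)) / real m) \<omega>)"
  shows "(\<integral>\<omega>. exp (l * (Y \<omega> - (\<integral>\<omega>. Y \<omega> \<partial>M))) \<partial>M)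
    \<le> exp (l * block_range TYPE('n) p + n * (l\<^sup>2 * (block_range TYPE('n) p)\<^sup>2 / 8))"
proof -
  interpret M: prob_space M using bm by (simp add: brownian_motion_def)
  have X[measurable]: "X t \<in> borel_measurable M" if "t \<ge> 0" for t
    using bm that by (simp add: brownian_motion_def)
  define \<sigma> where "\<sigma> j \<omega> i = X (real (min i (j * m)) / real m) \<omega>" for j \<omega> i
  define \<zeta> where "\<zeta> j \<omega> i = X (real (j * m + min i m) / real m) \<omega> - X (real (j * m) / real m) \<omega>" for j \<omega> i
  have \<sigma>: "\<sigma> j \<in> measurable M path_space" and \<zeta>[measurable]: "\<zeta> j \<in> measurable M path_space"
    and ind: "M.indep_var path_space (\<sigma> j) path_space (\<zeta> j)"
    and step: "\<sigma> (Suc j) \<omega> = append_block m j (\<sigma> j \<omega>) (\<zeta> j \<omega>)" for j \<omega>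
    unfolding \<sigma>_def \<zeta>_def by (rule brownian_motion_block_indep[OF bm m])+
  define Q where "Q j = distr M path_space (\<zeta> j)" for j
  define C where "C = cost_bound TYPE('n) p"
  have C0: "0 \<le> C" by (simp add: C_def cost_bound_nonneg)
  interpret W: mixing_block_walk m n Q "\<lambda>z. s * grid_cost p m n z" C "doeblin_const TYPE('n)" "- (C * n)" "C * n"
  proof (intro mixing_block_walk.intro block_walk.intro mixing_block_walk_axioms.intro)
    show "prob_space (Q j)" for j unfolding Q_def by (rule M.prob_space_distr) simp
    show "sets (Q j) = sets path_space" for j by (simp add: Q_def)
    show "(\<lambda>z. s * grid_cost p m n z) \<in> borel_measurable path_space"
      using grid_cost_measurable[OF p] by measurable
    show "- (C * n) \<le> s * grid_cost p m n z \<and> s * grid_cost p m n z \<le> C * n" for z :: "nat \<Rightarrow> real ^ 'n"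
      using grid_cost_bounds[OF p, of m n z] s by (auto simp: C_def)
    show "s * grid_cost p m n z = s * grid_cost p m n z'" if "\<And>i. z i - z' i \<in> int_lattice" for z z' :: "nat \<Rightarrow> real ^ 'n"
      using grid_cost_periodic[OF that] by simp
    show "\<bar>s * grid_cost p m n z - s * grid_cost p m n z'\<bar> \<le> C"
      if "l < n" "\<And>i. i < n * m \<Longrightarrow> i \<notin> {l * m..<Suc l * m} \<Longrightarrow> z i = z' i" for l and z z' :: "nat \<Rightarrow> real ^ 'n"
      using grid_cost_block[OF p m that(1), of z z'] that(2) s by (auto simp: C_def abs_minus_commute)
    show "\<bar>(\<integral>\<zeta>. G (x + \<zeta> m) \<partial>Q j) - (\<integral>\<zeta>. G (y + \<zeta> m) \<partial>Q j)\<bar> \<le> (1 - doeblin_const TYPE('n)) * K"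
      if G[measurable]: "G \<in> borel_measurable borel"
        and per: "\<And>x y. x - y \<in> int_lattice \<Longrightarrow> G x = G y" and osc: "\<And>x y. \<bar>G x - G y\<bar> \<le> K"
      for G :: "real ^ 'n \<Rightarrow> real" and x y K j
    proof -
      define N where "N = distr M lborel (\<lambda>\<omega>. \<zeta> j \<omega> m)"
      have [measurable]: "(\<lambda>\<omega>. \<zeta> j \<omega> m) \<in> borel_measurable M" unfolding \<zeta>_def by simp
      have "\<forall>s t. 0 \<le> s \<and> s < t \<longrightarrow> distributed M lborel (\<lambda>\<omega>. X t \<omega> - X s \<omega>)
          (\<lambda>x. ennreal (\<Prod>i\<in>UNIV. normal_density 0 (sqrt (t - s)) (x $ i)))"
        using bm unfolding brownian_motion_def by blast
      then have "distributed M lborel (\<lambda>\<omega>. X (real j + 1) \<omega> - X (real j) \<omega>)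
          (\<lambda>x. ennreal (\<Prod>i\<in>UNIV. normal_density 0 (sqrt ((real j + 1) - real j)) (x $ i)))"
        by (elim allE[of _ "real j"] allE[of _ "real j + 1"] mp) simp
      moreover have "(\<lambda>\<omega>. X (real j + 1) \<omega> - X (real j) \<omega>) = (\<lambda>\<omega>. \<zeta> j \<omega> m)"
        using m by (simp add: \<zeta>_def add_divide_distrib)
      ultimately have "distributed M lborel (\<lambda>\<omega>. \<zeta> j \<omega> m) (\<lambda>x. ennreal (gauss_density x))"
        by (simp add: gauss_density_def)
      then have N: "N = density lborel (\<lambda>x. ennreal (gauss_density x))"
        by (simp add: N_def distributed_def)
      have pN: "prob_space N" unfolding N_def by (rule M.prob_space_distr) simp
      have "(\<integral>\<zeta>. G (z + \<zeta> m) \<partial>Q j) = (\<integral>s. G (z + s) \<partial>N)" for z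
      proof -
        have "(\<integral>\<zeta>. G (z + \<zeta> m) \<partial>Q j) = (\<integral>\<omega>. G (z + \<zeta> j \<omega> m) \<partial>M)"
          unfolding Q_def by (rule integral_distr) measurable
        also have "\<dots> = (\<integral>s. G (z + s) \<partial>N)"
          unfolding N_def by (rule integral_distr[symmetric]) measurable
        finally show ?thesis .
      qed
      then show ?thesis using gaussian_step_contracts[OF pN N G per osc] by simp
    qed
  qed (use m n doeblin_const_pos doeblin_const_le_1 in auto)
  have "\<sigma> n = (\<lambda>\<omega> i. X (real (min i (n * m)) / real m) \<omega>)" by (intro ext) (simp add: \<sigma>_def)
  then have Y: "Y = (\<lambda>\<omega>. s * grid_cost p m n (\<sigma> n \<omega>))" by (simp add: Y_def)
  have R: "block_range TYPE('n) p = C + W.K" unfolding W.K_def by (simp add: block_range_def C_def)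
  have "(\<integral>\<omega>. exp (l * (Y \<omega> - (\<integral>\<omega>. Y \<omega> \<partial>M))) \<partial>M) \<le> exp (l * W.K + n * (l\<^sup>2 * (C + W.K)\<^sup>2 / 8))"
    unfolding Y by (rule W.exponential_moment[where \<sigma> = \<sigma> and \<zeta> = \<zeta>, OF M.prob_space_axioms \<sigma> \<zeta> ind _ step l])
      (simp add: Q_def)
  also have "\<dots> \<le> exp (l * block_range TYPE('n) p + n * (l\<^sup>2 * (block_range TYPE('n) p)\<^sup>2 / 8))"
    using C0 l unfolding R by (simp add: mult_left_mono)
  finally show ?thesis .
qed

section \<open>Passing to continuous time\<close>

text \<open>Extending the path by its initial value to negative times makes it continuous on the whole line
  and spares domain restrictions.\<close>
definition torus_path :: "(real \<Rightarrow> 'w \<Rightarrow> real ^ 'n::finite) \<Rightarrow> 'w \<Rightarrow> real \<Rightarrow> 'n torus" where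
  "torus_path X \<omega> t = torus_proj (X (max 0 t) \<omega>)"

lemma torus_path_continuous:
  assumes "continuous_on {0..} (\<lambda>t. X t \<omega>)"
  shows "continuous_on UNIV (torus_path X \<omega>)"
proof -
  have "continuous_on UNIV (\<lambda>t. X (max 0 t) \<omega>)"
    by (rule continuous_on_compose2[OF assms]) (auto intro: continuous_intros)
  then show ?thesis unfolding torus_path_def
    by (rule continuous_on_compose2[OF continuous_on_torus_proj[of UNIV]]) auto
qed

lemma torus_path_measurable:
  assumes "continuous_on {0..} (\<lambda>t. X t \<omega>)"
  shows "torus_path X \<omega> \<in> borel_measurable borel" "torus_path X \<omega> \<in> borel_measurable (time_interval T)"
proof -
  show *: "torus_path X \<omega> \<in> borel_measurable borel"
    by (rule borel_measurable_continuous_onI[OF torus_path_continuous[where X = X and \<omega> = \<omega>, OF assms]])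
  show "torus_path X \<omega> \<in> borel_measurable (time_interval T)"
    by (rule measurable_restrict_space1) (simp add: *)
qed

text \<open>A continuous path is uniformly continuous on the compact time interval, so its grid
  approximations converge uniformly there, and the cost is continuous under uniform convergence.\<close>
lemma grid_cost_tendsto:
  fixes X :: "real \<Rightarrow> 'w \<Rightarrow> real ^ 'n::finite"
  assumes p: "p > 0" and cont: "continuous_on {0..} (\<lambda>t. X t \<omega>)"
  shows "(\<lambda>k. grid_cost p (Suc k) n (\<lambda>i. X (real (min i (n * Suc k)) / real (Suc k)) \<omega>))
    \<longlonglongrightarrow> occ_cost p (real n) (torus_path X \<omega>)"
proof (rule tendstoI)
  fix \<epsilon> :: real assume \<epsilon>: "\<epsilon> > 0"
  define \<eta> where "\<eta> = \<epsilon> / (real n + 1)"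
  have \<eta>: "\<eta> > 0" "\<eta> * real n < \<epsilon>" using \<epsilon> by (auto simp: \<eta>_def field_simps)
  obtain \<delta> where \<delta>: "\<delta> > 0"
    "\<And>x x' y :: 'n torus. dist x x' < \<delta> \<Longrightarrow> \<bar>dist x y powr p - dist x' y powr p\<bar> \<le> \<eta>"
    using dist_powr_diff_modulus[OF p \<eta>(1)] by metis
  have "uniformly_continuous_on {0..real n} (torus_path X \<omega>)"
    by (intro compact_uniformly_continuous continuous_on_subset[OF torus_path_continuous[where X = X and \<omega> = \<omega>, OF cont]]) auto
  then obtain r where r: "r > 0"
    "\<And>t t'. t \<in> {0..real n} \<Longrightarrow> t' \<in> {0..real n} \<Longrightarrow> dist t' t < r \<Longrightarrow> dist (torus_path X \<omega> t') (torus_path X \<omega> t) < \<delta>"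
    using \<delta>(1) unfolding uniformly_continuous_on_def by metis
  have "\<forall>\<^sub>F k in sequentially. inverse (real (Suc k)) < r"
    using LIMSEQ_inverse_real_of_nat r(1) by (rule order_tendstoD(2))
  then show "\<forall>\<^sub>F k in sequentially.
      dist (grid_cost p (Suc k) n (\<lambda>i. X (real (min i (n * Suc k)) / real (Suc k)) \<omega>))
        (occ_cost p (real n) (torus_path X \<omega>)) < \<epsilon>"
  proof eventually_elim
    case (elim k)
    define m where "m = Suc k"
    have m: "real m > 0" by (simp add: m_def)
    let ?z = "\<lambda>i. X (real (min i (n * m)) / real m) \<omega>"
    have "\<bar>grid_cost p m n ?z - occ_cost p (real n) (torus_path X \<omega>)\<bar>
        \<le> \<eta> * real n + cost_bound TYPE('n) p * measure (time_interval (real n)) {}"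
      unfolding grid_cost_def
    proof (rule occ_cost_close[OF p])
      fix t and y :: "'n torus" assume "t \<in> {0..real n} - {}"
      then have t: "0 \<le> t" "t \<le> real n" by auto
      define i where "i = nat \<lfloor>t * real m\<rfloor>"
      have i: "real i \<le> t * real m" "t * real m < real i + 1"
      proof -
        have "real i = of_int \<lfloor>t * real m\<rfloor>" using t(1) by (simp add: i_def)
        then show "real i \<le> t * real m" "t * real m < real i + 1" by linarith+
      qed
      have "t * real m \<le> real n * real m" using t by (simp add: mult_right_mono)
      then have "real i \<le> real (n * m)" using i(1) by simp
      then have im: "i \<le> n * m" by (simp only: of_nat_le_iff)
      define t' where "t' = real i / real m"
      have t': "0 \<le> t'" "t' \<le> t" "t < t' + inverse (real m)"
        using i m by (auto simp: t'_def field_simps)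
      have "grid_path m ?z t = torus_path X \<omega> t'"
        using im t'(1) by (simp add: grid_path_def torus_path_def i_def[symmetric] t'_def min_absorb1)
      moreover have "dist (torus_path X \<omega> t') (torus_path X \<omega> t) < \<delta>"
        using t t' elim by (intro r(2)) (auto simp: dist_real_def m_def)
      ultimately show "\<bar>dist (grid_path m ?z t) y powr p - dist (torus_path X \<omega> t) y powr p\<bar> \<le> \<eta>"
        by (intro \<delta>(2)) simp
    qed (use \<eta> in \<open>auto intro: grid_path_measurable_time_interval torus_path_measurable(2)[where X = X and \<omega> = \<omega>, OF cont]\<close>)
    then show ?case using \<eta>(2) by (simp add: dist_real_def m_def)
  qed
qed

text \<open>A measurable version of the cost at time \<open>n\<close>.  The cost itself is controlled only for
  continuous paths, and the set of the others, although negligible, need not be measurable.  The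
  truncation keeps the version bounded where the limit fails to exist.\<close>
definition limit_cost :: "real \<Rightarrow> (real \<Rightarrow> 'w \<Rightarrow> real ^ 'n::finite) \<Rightarrow> nat \<Rightarrow> 'w \<Rightarrow> real" where
  "limit_cost p X n \<omega> = max 0 (min (cost_bound TYPE('n) p * n)
     (lim (\<lambda>k. grid_cost p (Suc k) n (\<lambda>i. X (real (min i (n * Suc k)) / real (Suc k)) \<omega>))))"

lemma limit_cost:
  fixes X :: "real \<Rightarrow> 'w \<Rightarrow> real ^ 'n::finite"
  assumes bm: "brownian_motion M X" and p: "p > 0"
  shows limit_cost_measurable: "limit_cost p X n \<in> borel_measurable M"
    and limit_cost_eq: "AE \<omega> in M. limit_cost p X n \<omega> = occ_cost p (real n) (torus_path X \<omega>)"
    and limit_cost_bound: "\<bar>limit_cost p X n \<omega>\<bar> \<le> cost_bound TYPE('n) p * n"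
    and limit_cost_exponential_moment: "n > 0 \<Longrightarrow> l > 0 \<Longrightarrow> s = 1 \<or> s = -1 \<Longrightarrow>
      (\<integral>\<omega>. exp (l * (s * (limit_cost p X n \<omega> - (\<integral>\<omega>. limit_cost p X n \<omega> \<partial>M)))) \<partial>M)
      \<le> exp (l * block_range TYPE('n) p + n * (l\<^sup>2 * (block_range TYPE('n) p)\<^sup>2 / 8))"
proof -
  interpret M: prob_space M using bm by (simp add: brownian_motion_def)
  have X[measurable]: "X t \<in> borel_measurable M" if "t \<ge> 0" for t
    using bm that by (simp add: brownian_motion_def)
  have cont: "AE \<omega> in M. continuous_on {0..} (\<lambda>t. X t \<omega>)"
    using bm by (simp add: brownian_motion_def)
  define C where "C = cost_bound TYPE('n) p * real n"
  have C0: "0 \<le> C" by (simp add: C_def cost_bound_nonneg)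
  define G where "G k \<omega> = grid_cost p (Suc k) n (\<lambda>i. X (real (min i (n * Suc k)) / real (Suc k)) \<omega>)" for k \<omega>
  have G[measurable]: "G k \<in> borel_measurable M" for k
  proof -
    have "(\<lambda>\<omega> i. X (real (min i (n * Suc k)) / real (Suc k)) \<omega>) \<in> measurable M path_space"
      by (rule measurable_PiM_single') (auto simp: space_PiM)
    then show ?thesis unfolding G_def by (rule measurable_compose[OF _ grid_cost_measurable[OF p]])
  qed
  have Gb: "0 \<le> G k \<omega>" "G k \<omega> \<le> C" for k \<omega>
    using grid_cost_bounds[OF p] by (auto simp: G_def C_def)
  define Y where "Y = limit_cost p X n"
  have Y_eq: "Y \<omega> = max 0 (min C (lim (\<lambda>k. G k \<omega>)))" for \<omega>
    by (simp add: Y_def limit_cost_def C_def G_def)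
  have Ym[measurable]: "Y \<in> borel_measurable M" unfolding Y_eq[abs_def] by measurable
  show "limit_cost p X n \<in> borel_measurable M" using Ym by (simp only: Y_def)
  have lim: "AE \<omega> in M. (\<lambda>k. G k \<omega>) \<longlonglongrightarrow> Y \<omega> \<and> Y \<omega> = occ_cost p (real n) (torus_path X \<omega>)"
    using cont
  proof eventually_elim
    case (elim \<omega>)
    note L = grid_cost_tendsto[where X = X and \<omega> = \<omega> and n = n, OF p elim, folded G_def]
    have "0 \<le> occ_cost p (real n) (torus_path X \<omega>)"
      by (rule LIMSEQ_le_const[OF L]) (use Gb in auto)
    moreover have "occ_cost p (real n) (torus_path X \<omega>) \<le> C"
      by (rule LIMSEQ_le_const2[OF L]) (use Gb in auto)
    ultimately have "Y \<omega> = occ_cost p (real n) (torus_path X \<omega>)" using limI[OF L] by (simp add: Y_eq)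
    with L show ?case by simp
  qed
  have EG: "(\<lambda>k. \<integral>\<omega>. G k \<omega> \<partial>M) \<longlonglongrightarrow> (\<integral>\<omega>. Y \<omega> \<partial>M)"
    by (rule integral_dominated_convergence[where w="\<lambda>_. C"]) (use lim Gb in auto)
  show "AE \<omega> in M. limit_cost p X n \<omega> = occ_cost p (real n) (torus_path X \<omega>)"
    using lim by eventually_elim (simp add: Y_def)
  have "\<bar>Y \<omega>\<bar> \<le> C" using C0 by (simp add: Y_eq)
  then show "\<bar>limit_cost p X n \<omega>\<bar> \<le> cost_bound TYPE('n) p * n" by (simp only: Y_def C_def)
  show "(\<integral>\<omega>. exp (l * (s * (limit_cost p X n \<omega> - (\<integral>\<omega>. limit_cost p X n \<omega> \<partial>M)))) \<partial>M)
      \<le> exp (l * block_range TYPE('n) p + n * (l\<^sup>2 * (block_range TYPE('n) p)\<^sup>2 / 8))"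
    if n: "n > 0" and l: "l > 0" and s: "s = 1 \<or> s = -1"
  proof -
    let ?b = "exp (l * block_range TYPE('n) p + n * (l\<^sup>2 * (block_range TYPE('n) p)\<^sup>2 / 8))"
    have "(\<lambda>k. \<integral>\<omega>. exp (l * (s * (G k \<omega> - (\<integral>\<omega>. G k \<omega> \<partial>M)))) \<partial>M)
        \<longlonglongrightarrow> (\<integral>\<omega>. exp (l * (s * (Y \<omega> - (\<integral>\<omega>. Y \<omega> \<partial>M)))) \<partial>M)"
    proof (rule integral_dominated_convergence[where w="\<lambda>_. exp (l * C)"])
      show "AE \<omega> in M. (\<lambda>k. exp (l * (s * (G k \<omega> - (\<integral>\<omega>. G k \<omega> \<partial>M)))))
          \<longlonglongrightarrow> exp (l * (s * (Y \<omega> - (\<integral>\<omega>. Y \<omega> \<partial>M))))"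
        using lim by eventually_elim (intro tendsto_intros EG, auto)
      fix k
      have "0 \<le> (\<integral>\<omega>. G k \<omega> \<partial>M)" "(\<integral>\<omega>. G k \<omega> \<partial>M) \<le> C"
        using Gb by (auto intro!: integral_nonneg_AE M.integral_le_const M.integrable_const_bound[where B=C])
      then have "s * (G k \<omega> - (\<integral>\<omega>. G k \<omega> \<partial>M)) \<le> C" for \<omega>
        using Gb[of k \<omega>] s by auto
      then show "AE \<omega> in M. norm (exp (l * (s * (G k \<omega> - (\<integral>\<omega>. G k \<omega> \<partial>M))))) \<le> exp (l * C)"
        using l by simp
    qed (auto)
    moreover have "(\<integral>\<omega>. exp (l * (s * (G k \<omega> - (\<integral>\<omega>. G k \<omega> \<partial>M)))) \<partial>M) \<le> ?b" for k
    proof -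
      have "(\<integral>\<omega>. s * G k \<omega> \<partial>M) = s * (\<integral>\<omega>. G k \<omega> \<partial>M)" by (rule integral_mult_right_zero)
      then show ?thesis
        using grid_cost_exponential_moment[OF bm p _ n l s, of "Suc k"]
        by (simp add: G_def right_diff_distrib)
    qed
    ultimately have "(\<integral>\<omega>. exp (l * (s * (Y \<omega> - (\<integral>\<omega>. Y \<omega> \<partial>M)))) \<partial>M) \<le> ?b"
      by (intro LIMSEQ_le_const2) auto
    then show ?thesis unfolding Y_def .
  qed
qed

section \<open>Almost sure convergence\<close>

text \<open>The function \<open>f\<close> may be non-measurable; monotonicity of the integral between two measurable
  functions suffices.\<close>
lemma (in prob_space) enn2real_nn_integral_close:
  fixes f :: "'a \<Rightarrow> ennreal" and Y :: "'a \<Rightarrow> real"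
  assumes [measurable]: "Y \<in> borel_measurable M" and Yb: "\<And>\<omega>. \<bar>Y \<omega>\<bar> \<le> b" and c: "c \<ge> 0"
    and close: "AE \<omega> in M. \<exists>r\<ge>0. f \<omega> = ennreal r \<and> \<bar>r - Y \<omega>\<bar> \<le> c"
  shows "\<bar>enn2real (\<integral>\<^sup>+ \<omega>. f \<omega> \<partial>M) - (\<integral>\<omega>. Y \<omega> \<partial>M)\<bar> \<le> c"
proof -
  have Yi: "integrable M Y" using Yb by (intro integrable_const_bound[where B=b]) auto
  have mi: "integrable M (\<lambda>\<omega>. max 0 (Y \<omega> - c))" using Yi by (intro integrable_max) auto
  have "AE \<omega> in M. 0 \<le> Y \<omega> + c" using close by eventually_elim auto
  then have up: "(\<integral>\<^sup>+ \<omega>. ennreal (Y \<omega> + c) \<partial>M) = ennreal (\<integral>\<omega>. Y \<omega> + c \<partial>M)" "0 \<le> (\<integral>\<omega>. Y \<omega> + c \<partial>M)"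
    using Yi by (intro nn_integral_eq_integral integral_nonneg_AE; simp)+
  have "(\<integral>\<^sup>+ \<omega>. f \<omega> \<partial>M) \<le> (\<integral>\<^sup>+ \<omega>. ennreal (Y \<omega> + c) \<partial>M)"
    using close by (intro nn_integral_mono_AE, eventually_elim) (auto intro!: ennreal_leI)
  then have le: "(\<integral>\<^sup>+ \<omega>. f \<omega> \<partial>M) \<le> ennreal (\<integral>\<omega>. Y \<omega> + c \<partial>M)" by (simp only: up(1))
  then have 1: "enn2real (\<integral>\<^sup>+ \<omega>. f \<omega> \<partial>M) \<le> (\<integral>\<omega>. Y \<omega> \<partial>M) + c"
    using enn2real_leI[OF up(2) le] Yi by (simp add: prob_space)
  have "ennreal (\<integral>\<omega>. max 0 (Y \<omega> - c) \<partial>M) = (\<integral>\<^sup>+ \<omega>. ennreal (max 0 (Y \<omega> - c)) \<partial>M)"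
    using mi by (intro nn_integral_eq_integral[symmetric]) auto
  also have "\<dots> \<le> (\<integral>\<^sup>+ \<omega>. f \<omega> \<partial>M)"
    using close by (intro nn_integral_mono_AE, eventually_elim) (auto intro!: ennreal_leI)
  finally have "enn2real (ennreal (\<integral>\<omega>. max 0 (Y \<omega> - c) \<partial>M)) \<le> enn2real (\<integral>\<^sup>+ \<omega>. f \<omega> \<partial>M)"
    using le by (intro enn2real_mono) (auto simp: less_top[symmetric] top_unique)
  moreover have "(\<integral>\<omega>. Y \<omega> - c \<partial>M) \<le> (\<integral>\<omega>. max 0 (Y \<omega> - c) \<partial>M)"
    using mi Yi by (intro integral_mono) auto
  moreover have "0 \<le> (\<integral>\<omega>. max 0 (Y \<omega> - c) \<partial>M)" by (intro integral_nonneg_AE) auto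
  ultimately have "(\<integral>\<omega>. Y \<omega> \<partial>M) - c \<le> enn2real (\<integral>\<^sup>+ \<omega>. f \<omega> \<partial>M)"
    using Yi by (simp add: prob_space)
  with 1 show ?thesis by (simp add: abs_le_iff)
qed

lemma summable_stretched_exponential:
  assumes "\<delta> > 0"
  shows "summable (\<lambda>n. exp (- (real n powr \<delta>)))"
proof (rule summable_comparison_test_ev)
  have "((\<lambda>x. exp (- (x powr \<delta>)) * x powr 2) \<longlongrightarrow> 0) at_top" using assms by real_asymp
  then have "\<forall>\<^sub>F x in at_top. exp (- (x powr \<delta>)) * x powr 2 < 1" by (rule order_tendstoD) simp
  then have "\<forall>\<^sub>F n in sequentially. exp (- (real n powr \<delta>)) * real n powr 2 < 1"
    using filterlim_real_sequentially by (rule eventually_compose_filterlim)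
  then show "\<forall>\<^sub>F n in sequentially. norm (exp (- (real n powr \<delta>))) \<le> real n powr (-2)"
    using eventually_gt_at_top[of 0]
    by eventually_elim (simp add: powr_minus field_simps)
  show "summable (\<lambda>n. real n powr (-2))" by (simp add: summable_real_powr_iff)
qed

text \<open>With \<open>l = n\<^sup>-\<^sup>1\<^sup>/\<^sup>2\<close> the exponential moments are bounded uniformly in \<open>n\<close>, and a
  deviation by \<open>n\<^sup>1\<^sup>/\<^sup>2\<^sup>+\<^sup>\<delta>\<close> has probability of order \<open>exp (- n\<^sup>\<delta>)\<close>, which is summable.\<close>
lemma (in prob_space) eventually_close_to_mean:
  fixes Y :: "nat \<Rightarrow> 'a \<Rightarrow> real"
  assumes [measurable]: "\<And>n. Y n \<in> borel_measurable M" and Yb: "\<And>n \<omega>. n > 0 \<Longrightarrow> \<bar>Y n \<omega>\<bar> \<le> b n"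
    and R: "R \<ge> 0" and \<delta>: "\<delta> > 0"
    and mgf: "\<And>n l s. n > 0 \<Longrightarrow> l > 0 \<Longrightarrow> s = 1 \<or> s = -1 \<Longrightarrow>
      (\<integral>\<omega>. exp (l * (s * (Y n \<omega> - (\<integral>\<omega>. Y n \<omega> \<partial>M)))) \<partial>M) \<le> exp (l * R + real n * (l\<^sup>2 * R\<^sup>2 / 8))"
  shows "AE \<omega> in M. \<forall>\<^sub>F n in sequentially. \<bar>Y n \<omega> - (\<integral>\<omega>. Y n \<omega> \<partial>M)\<bar> < real n powr (1/2 + \<delta>)"
proof -
  define D where "D n \<omega> = Y n \<omega> - (\<integral>\<omega>. Y n \<omega> \<partial>M)" for n \<omega>
  have [measurable]: "D n \<in> borel_measurable M" for n unfolding D_def by measurable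
  define A where "A n = {\<omega> \<in> space M. \<bar>D n \<omega>\<bar> \<ge> real n powr (1/2 + \<delta>)}" for n
  have A[measurable]: "A n \<in> sets M" for n unfolding A_def by measurable
  have tail: "measure M {\<omega> \<in> space M. s * D n \<omega> \<ge> real n powr (1/2 + \<delta>)} \<le> exp (R + R\<^sup>2 / 8) * exp (- (real n powr \<delta>))"
    if n: "n > 0" and s: "s = 1 \<or> s = -1" for n s
  proof -
    define l where "l = real n powr (- (1/2))"
    have l: "0 < l" "l \<le> 1" using n powr_mono[of "- (1/2)" 0 "real n"] by (auto simp: l_def)
    have l2: "real n * l\<^sup>2 = 1"
      using n by (simp add: l_def power2_eq_square powr_add[symmetric] powr_minus field_simps)
    have la: "l * real n powr (1/2 + \<delta>) = real n powr \<delta>" by (simp add: l_def powr_add[symmetric])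
    have int: "integrable M (\<lambda>\<omega>. exp (l * (s * D n \<omega>)))"
    proof (rule integrable_const_bound)
      have "\<bar>D n \<omega>\<bar> \<le> b n + \<bar>\<integral>\<omega>. Y n \<omega> \<partial>M\<bar>" for \<omega> using Yb[OF n, of \<omega>] by (simp add: D_def)
      then have "s * D n \<omega> \<le> b n + \<bar>\<integral>\<omega>. Y n \<omega> \<partial>M\<bar>" for \<omega>
        using s by (auto simp: abs_le_iff)
      then show "AE \<omega> in M. norm (exp (l * (s * D n \<omega>))) \<le> exp (l * (b n + \<bar>\<integral>\<omega>. Y n \<omega> \<partial>M\<bar>))"
        using l by (auto intro!: AE_I2 mult_left_mono)
    qed measurable
    have "measure M {\<omega> \<in> space M. s * D n \<omega> \<ge> real n powr (1/2 + \<delta>)}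
        \<le> exp (- l * real n powr (1/2 + \<delta>)) * (\<integral>\<omega>\<in>space M. exp (l * (s * D n \<omega>)) \<partial>M)"
    proof (rule Chernoff_ineq_ge[OF l(1)])
      show "set_integrable M (space M) (\<lambda>\<omega>. exp (l * (s * D n \<omega>)))"
        unfolding set_integrable_def by (rule integrable_mult_indicator[OF sets.top int])
    qed simp
    also have "(\<integral>\<omega>\<in>space M. exp (l * (s * D n \<omega>)) \<partial>M) = (\<integral>\<omega>. exp (l * (s * D n \<omega>)) \<partial>M)"
      by (rule set_integral_space[OF int])
    also have "\<dots> \<le> exp (l * R + real n * (l\<^sup>2 * R\<^sup>2 / 8))"
      unfolding D_def by (rule mgf[OF n l(1) s])
    also have "real n * (l\<^sup>2 * R\<^sup>2 / 8) = R\<^sup>2 / 8" using l2 by (simp add: mult.assoc[symmetric])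
    also have "exp (l * R + R\<^sup>2 / 8) \<le> exp (R + R\<^sup>2 / 8)" using l R by (simp add: mult_left_le_one_le)
    finally show ?thesis by (simp add: la mult.commute mult_left_mono)
  qed
  have mA: "measure M (A n) \<le> 2 * exp (R + R\<^sup>2 / 8) * exp (- (real n powr \<delta>))" if n: "n > 0" for n
  proof -
    let ?P = "\<lambda>s. {\<omega> \<in> space M. s * D n \<omega> \<ge> real n powr (1/2 + \<delta>)}"
    have "A n \<subseteq> ?P 1 \<union> ?P (-1)" by (auto simp: A_def)
    then have "measure M (A n) \<le> measure M (?P 1 \<union> ?P (-1))" by (intro finite_measure_mono) auto
    also have "\<dots> \<le> measure M (?P 1) + measure M (?P (-1))" by (intro measure_Un_le) auto
    finally show ?thesis using tail[OF n, of 1] tail[OF n, of "-1"] by simp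
  qed
  have "summable (\<lambda>n. measure M (A n))"
  proof (rule summable_comparison_test_ev)
    show "\<forall>\<^sub>F n in sequentially. norm (measure M (A n)) \<le> 2 * exp (R + R\<^sup>2 / 8) * exp (- (real n powr \<delta>))"
      using eventually_gt_at_top[of 0] by eventually_elim (simp add: mA)
    show "summable (\<lambda>n. 2 * exp (R + R\<^sup>2 / 8) * exp (- (real n powr \<delta>)))"
      by (intro summable_mult summable_stretched_exponential \<delta>)
  qed
  then have "AE \<omega> in M. \<forall>\<^sub>F n in sequentially. \<omega> \<in> space M - A n"
    by (intro borel_cantelli_AE1) (auto simp: less_top[symmetric])
  then show ?thesis
  proof eventually_elim
    case (elim \<omega>)
    then show ?case by eventually_elim (auto simp: A_def D_def)
  qed
qed

text \<open>For \<open>d \<ge> 5\<close> the factor \<open>(1 + x) / (3 + x)\<close> with \<open>x = p / d\<close> is below one, whence \<open>p < d\<close>; then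
  \<open>x < 1\<close>, and the factor is in fact below \<open>1/2\<close>.\<close>
lemma exponent_below_half:
  fixes p :: real and d :: nat
  assumes "d \<ge> 3" "p > 0"
    and "d \<in> {3, 4} \<Longrightarrow> p < (real d - 2) / 3"
    and "d \<ge> 5 \<Longrightarrow> p < (real d - 2) * ((1 + p / real d) / (3 + p / real d))"
  shows "p / (real d - 2) < 1 / 2"
proof (cases "d \<ge> 5")
  case False
  then have "d \<in> {3, 4}" using assms(1) by auto
  then show ?thesis using assms(2,3) by auto
next
  case True
  define x where "x = p / real d"
  have x: "x > 0" using assms(1,2) by (simp add: x_def)
  have p: "p < (real d - 2) * ((1 + x) / (3 + x))" using assms(4)[OF True] by (simp add: x_def)
  have d2: "real d - 2 > 0" using True by simp
  have "(real d - 2) * ((1 + x) / (3 + x)) < (real d - 2) * 1"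
    using x d2 by (intro mult_strict_left_mono) (auto simp: field_simps)
  with p have "p < (real d - 2) * 1" by (rule less_trans)
  then have "p < real d" by simp
  then have "x < 1" using True by (simp add: x_def)
  then have "(1 + x) / (3 + x) < 1 / 2" using x by (simp add: field_simps)
  then have "(real d - 2) * ((1 + x) / (3 + x)) < (real d - 2) * (1 / 2)"
    using d2 by (intro mult_strict_left_mono)
  with p have "p < (real d - 2) * (1 / 2)" by (rule less_trans)
  then show ?thesis using d2 by (simp add: field_simps)
qed

theorem proposition6p1:
  fixes M :: "'w measure"
    and B :: "real \<Rightarrow> 'w \<Rightarrow> 'n::finite torus"
    and d :: nat
    and p :: real
  assumes "d = CARD('n)"
    and "d \<ge> 3"
    and "stationary_torus_bm M B"
    and "p > 0"
    and "d \<in> {3, 4} \<Longrightarrow> p < (real d - 2) / 3"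
    and "d \<ge> 5 \<Longrightarrow> p < (real d - 2) * ((1 + p / real d) / (3 + p / real d))"
  shows "AE \<omega> in M.
    ((\<lambda>T. \<bar>enn2real (torus_Wp p (occupation_measure B T \<omega>))
            - enn2real (\<integral>\<^sup>+ \<omega>'. torus_Wp p (occupation_measure B T \<omega>') \<partial>M)\<bar>
          / T powr (1 - p / (real d - 2))) \<longlongrightarrow> 0) at_top"
proof -
  obtain X where bm: "brownian_motion M X"
    and BX: "\<And>t \<omega>. t \<ge> 0 \<Longrightarrow> \<omega> \<in> space M \<Longrightarrow> B t \<omega> = torus_proj (X t \<omega>)"
    using assms(3) unfolding stationary_torus_bm_def by blast
  note p = \<open>p > 0\<close>
  interpret M: prob_space M using bm by (simp add: brownian_motion_def)
  define C where "C = cost_bound TYPE('n) p"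
  have C0: "C \<ge> 0" by (simp add: C_def cost_bound_nonneg)
  define q where "q = p / (real d - 2)"
  have q: "q < 1 / 2" unfolding q_def by (rule exponent_below_half[OF assms(2,4-6)])
  \<comment> \<open>Half of the gap between the fluctuation exponent 1/2 and the normalising exponent.\<close>
  define \<delta> where "\<delta> = 1/4 - q/2"
  have \<delta>: "\<delta> > 0" "1/2 + \<delta> < 1 - q" using q by (simp_all add: \<delta>_def field_simps)

  have cont: "AE \<omega> in M. continuous_on {0..} (\<lambda>t. X t \<omega>)"
    using bm by (simp add: brownian_motion_def)
  have Wp: "torus_Wp p (occupation_measure B T \<omega>) = ennreal (occ_cost p T (torus_path X \<omega>))"
    if "\<omega> \<in> space M" "continuous_on {0..} (\<lambda>t. X t \<omega>)" for T \<omega>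
  proof -
    have "occupation_measure B T \<omega> = distr (time_interval T) borel (torus_path X \<omega>)"
      unfolding occupation_measure_def
      using that(1) by (intro distr_cong) (auto simp: BX torus_path_def)
    then show ?thesis
      using torus_Wp_distr_finite(1)[OF finite_measure_time_interval p torus_path_measurable(2)[where X = X, OF that(2)], of T]
      by (simp add: occ_cost_def less_top)
  qed

  define Y where "Y = limit_cost p X"
  have Ym[measurable]: "Y n \<in> borel_measurable M" for n
    unfolding Y_def by (rule limit_cost_measurable[OF bm p])
  have Yb: "\<bar>Y n \<omega>\<bar> \<le> C * real n" for n \<omega>
    unfolding Y_def C_def by (rule limit_cost_bound[OF bm p])
  have R0: "0 \<le> block_range TYPE('n) p"
    using doeblin_const_pos[where 'n='n] by (simp add: block_range_def cost_bound_nonneg)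
  have conc: "AE \<omega> in M. \<forall>\<^sub>F n in sequentially. \<bar>Y n \<omega> - (\<integral>\<omega>. Y n \<omega> \<partial>M)\<bar> < real n powr (1/2 + \<delta>)"
    using limit_cost_exponential_moment[OF bm p]
    by (intro M.eventually_close_to_mean[OF Ym Yb R0 \<delta>(1)]) (simp add: Y_def)
  have Yeq: "AE \<omega> in M. \<forall>n. Y n \<omega> = occ_cost p (real n) (torus_path X \<omega>)"
    unfolding Y_def by (intro AE_all_countable[THEN iffD2] allI limit_cost_eq[OF bm p])

  have inter: "\<bar>occ_cost p T (torus_path X \<omega>) - occ_cost p (real (nat \<lfloor>T\<rfloor>)) (torus_path X \<omega>)\<bar> \<le> 2 * C"
    if "T \<ge> 1" "continuous_on {0..} (\<lambda>t. X t \<omega>)" for T \<omega>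
  proof -
    have n: "real (nat \<lfloor>T\<rfloor>) = of_int \<lfloor>T\<rfloor>" using that(1) by simp
    have "\<bar>occ_cost p T (torus_path X \<omega>) - occ_cost p (real (nat \<lfloor>T\<rfloor>)) (torus_path X \<omega>)\<bar>
        \<le> 2 * C * (T - real (nat \<lfloor>T\<rfloor>))"
      unfolding C_def using that(1)
      by (intro occ_cost_time_diff[OF p] torus_path_measurable(1)[where X = X, OF that(2)]) auto
    also have "\<dots> \<le> 2 * C * 1" using C0 unfolding n by (intro mult_left_mono) (auto, linarith)
    finally show ?thesis by simp
  qed
  have mean: "\<bar>enn2real (\<integral>\<^sup>+ \<omega>. torus_Wp p (occupation_measure B T \<omega>) \<partial>M) - (\<integral>\<omega>. Y (nat \<lfloor>T\<rfloor>) \<omega> \<partial>M)\<bar> \<le> 2 * C"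
    if T: "T \<ge> 1" for T
  proof (rule M.enn2real_nn_integral_close[OF Ym Yb])
    show "AE \<omega> in M. \<exists>r\<ge>0. torus_Wp p (occupation_measure B T \<omega>) = ennreal r \<and> \<bar>r - Y (nat \<lfloor>T\<rfloor>) \<omega>\<bar> \<le> 2 * C"
      using cont Yeq AE_space
    proof eventually_elim
      case (elim \<omega>)
      then show ?case using inter[OF T elim(1)] Wp[OF elim(3,1), of T] occ_cost_nonneg
        by (intro exI[of _ "occ_cost p T (torus_path X \<omega>)"]) auto
    qed
  qed (use C0 in simp)

  show ?thesis
    using cont Yeq conc AE_space
  proof eventually_elim
    case (elim \<omega>)
    let ?dev = "\<lambda>T. \<bar>enn2real (torus_Wp p (occupation_measure B T \<omega>))
            - enn2real (\<integral>\<^sup>+ \<omega>'. torus_Wp p (occupation_measure B T \<omega>') \<partial>M)\<bar>"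
    note \<omega> = elim(4,1)
    have eqY: "Y n \<omega> = occ_cost p (real n) (torus_path X \<omega>)" for n using elim(2) by simp
    have floor_top: "filterlim (\<lambda>T :: real. nat \<lfloor>T\<rfloor>) sequentially at_top"
      by (intro filterlim_compose[OF filterlim_nat_sequentially] filterlim_floor_sequentially)
    have "\<forall>\<^sub>F T :: real in at_top. \<bar>Y (nat \<lfloor>T\<rfloor>) \<omega> - (\<integral>\<omega>. Y (nat \<lfloor>T\<rfloor>) \<omega> \<partial>M)\<bar> < real (nat \<lfloor>T\<rfloor>) powr (1/2 + \<delta>)"
      by (rule floor_top[unfolded filterlim_iff, rule_format, OF elim(3)])
    then have bound: "\<forall>\<^sub>F T in at_top. ?dev T / T powr (1 - q)
        \<le> T powr (1/2 + \<delta> - (1 - q)) + 4 * C * T powr (- (1 - q))"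
      using eventually_ge_at_top[of "1 :: real"]
    proof eventually_elim
      case (elim T)
      have n: "real (nat \<lfloor>T\<rfloor>) \<le> T" using elim(2) by simp
      have "enn2real (torus_Wp p (occupation_measure B T \<omega>)) = occ_cost p T (torus_path X \<omega>)"
        unfolding Wp[OF \<omega>, of T] by (rule enn2real_ennreal[OF occ_cost_nonneg])
      moreover have "occ_cost p (real (nat \<lfloor>T\<rfloor>)) (torus_path X \<omega>) = Y (nat \<lfloor>T\<rfloor>) \<omega>"
        by (simp only: eqY)
      ultimately have "?dev T \<le> \<bar>Y (nat \<lfloor>T\<rfloor>) \<omega> - (\<integral>\<omega>. Y (nat \<lfloor>T\<rfloor>) \<omega> \<partial>M)\<bar> + 4 * C"
        using mean[OF elim(2)] inter[OF elim(2) \<omega>(2)] by linarith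
      also have "\<dots> \<le> real (nat \<lfloor>T\<rfloor>) powr (1/2 + \<delta>) + 4 * C" using elim(1) by simp
      also have "\<dots> \<le> T powr (1/2 + \<delta>) + 4 * C" using n \<delta>(1) by (intro add_right_mono powr_mono2) auto
      finally have "?dev T / T powr (1 - q) \<le> (T powr (1/2 + \<delta>) + 4 * C) / T powr (1 - q)"
        by (intro divide_right_mono) auto
      also have "\<dots> = T powr (1/2 + \<delta> - (1 - q)) + 4 * C * T powr (- (1 - q))"
        unfolding powr_diff powr_minus add_divide_distrib by (simp only: divide_inverse)
      finally show ?case .
    qed
    have "((\<lambda>T. T powr (1/2 + \<delta> - (1 - q)) + 4 * C * T powr (- (1 - q))) \<longlongrightarrow> 0 + 4 * C * 0) at_top"
      using \<delta> q by (intro tendsto_add tendsto_mult tendsto_const tendsto_neg_powr filterlim_ident) auto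
    then have lim: "((\<lambda>T. T powr (1/2 + \<delta> - (1 - q)) + 4 * C * T powr (- (1 - q))) \<longlongrightarrow> 0) at_top" by simp
    show ?case unfolding q_def[symmetric]
      by (rule tendsto_sandwich[OF _ bound tendsto_const lim]) simp
  qed
qed

end
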